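(* Let $T\in\mathbb{C}\setminus\{0\}$, let $p\colon\mathbb{C}\to\mathbb{C}$ be an entire $T$-periodic function such that the function $z\mapsto z+p(z)$ has an attracting fixed point at $z_0\in\mathbb{C}$, let $g\colon\mathbb{C}\to\mathbb{C}$ be entire with an attracting fixed point at $0$, and let $h\colon\mathbb{C}^2\to\mathbb{C}$ be entire. Put $f(z)=z+T+p(z)$ and consider the skew-product $F\colon\mathbb{C}^2\to\mathbb{C}^2$, $$F(z,w)=(f(z)+w\,h(z,w),\,g(w))=(z+T+p(z)+w\,h(z,w),\,g(w)).$$ Assume that there exist $\delta>0$ and a sequence $(\rho_k)_{k\in\mathbb{N}}$ of positive real numbers with $g(\overline{D(0,\rho_k)})\subset\overline{D(0,\rho_{k+1})}$ for every $k\in\mathbb{N}$ such that $$\sum_{k=0}^{\infty}\rho_k\max_{\substack{|w|\le\rho_k,\\ |z-(z_0+kT)|\le\delta}}|h(z,w)|<\infty.$$ Then the wandering domain $U_0$ of $f$ at $z_0$ bulges to a Fatou component of $F$, i.e. $U_0\times\{0\}$ is contained in the Fatou set of $F$ (for each of the three notions of normality: $\widehat{\mathbb{C}^2}$, $\mathbf{P}_2\mathbb{C}$ and $\widehat{\mathbb{C}}\times\widehat{\mathbb{C}}$).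
   Context: $D(a,r)$ is the open disk of center $a$ and radius $r$ in $\mathbb{C}$; $\mathbb{N}$ includes $0$. A fixed point $c$ of an entire function $u$ is attracting if $|u'(c)|<1$. The Fatou set of an entire function of one variable is the set of normality (with values in the Riemann sphere) of its iterates; its connected components are called Fatou components. The wandering domain $U_0$ of $f$ at $z_0$ is the Fatou component of $f$ containing $z_0$; it is the (immediate) basin of attraction of $z_0$ for $z\mapsto z+p(z)$, and it is known that the sets $U_0+nT$, $n\in\mathbb{Z}$, are pairwise disjoint Fatou components of $f$ with $f(U_0+nT)\subset U_0+(n+1)T$. Let $X$ be a complex manifold and let $\mathcal{F}$ be a family of holomorphic maps $X\to\mathbb{C}^2$. - $\mathcal{F}$ is $\widehat{\mathbb{C}^2}$-normal if every sequence in $\mathcal{F}$ either diverges uniformly to infinity on compact subsets of $X$ or has a subsequence converging uniformly on compact subsets to a holomorphic map $X\to\mathbb{C}^2$. (Here $\widehat{\mathbb{C}^2}$ is the one-point compactification.) - $\mathcal{F}$ is $\mathbf{P}_2\mathbb{C}$-normal if every sequence in $\mathcal{F}$ has a subsequence converging uniformly on compact subsets to a holomorphic map $X\to\mathbf{P}_2\mathbb{C}$ (with $\mathbb{C}^2\subset\mathbf{P}_2\mathbb{C}$ the complex projective plane). - $\mathcal{F}$ is $(\widehat{\mathbb{C}})^2$-normal if every sequence in $\mathcal{F}$ has a subsequence converging uniformly on compact subsets to a holomorphic map $X\to\widehat{\mathbb{C}}\times\widehat{\mathbb{C}}$. For a holomorphic map $F\colon\mathbb{C}^2\to\mathbb{C}^2$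 and any of these notions, the Fatou set of $F$ is the set of points having an open neighborhood on which the family of iterates $(F^n)_{n\in\mathbb{N}}$ is normal. When no notion is specified, statements are meant for all three. *)

theory Defs
  imports "HOL-Analysis.Analysis"
begin

section \<open>Holomorphic maps in one and several complex variables\<close>

text \<open>The distribution has no class of complex normed spaces; this one lets \<open>complex\<close> and
  \<open>complex \<times> complex\<close> be treated uniformly.\<close>

class complex_space = real_normed_vector +
  fixes cscale :: "complex \<Rightarrow> 'a \<Rightarrow> 'a"
  assumes cscale_add_right: "cscale c (x + y) = cscale c x + cscale c y"
    and cscale_add_left: "cscale (c + d) x = cscale c x + cscale d x"
    and cscale_cscale: "cscale c (cscale d x) = cscale (c * d) x"
    and cscale_of_real: "cscale (complex_of_real r) x = r *\<^sub>R x"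
    and norm_cscale: "norm (cscale c x) = cmod c * norm x"

instantiation complex :: complex_space
begin
definition cscale_complex_def: "cscale c (x::complex) = c * x"
instance
  by standard (simp_all add: cscale_complex_def algebra_simps norm_mult scaleR_conv_of_real)
end

instantiation prod :: (complex_space, complex_space) complex_space
begin
definition cscale_prod_def: "cscale c x = (cscale c (fst x), cscale c (snd x))"
instance
proof
  fix c and x :: "'a \<times> 'b"
  show "norm (cscale c x) = cmod c * norm x"
    by (simp add: cscale_prod_def norm_prod_def norm_cscale power_mult_distrib
        flip: distrib_left real_sqrt_mult)
      (simp add: real_sqrt_mult flip: distrib_left)
qed (simp_all add: cscale_prod_def cscale_add_right cscale_add_left cscale_cscale cscale_of_real
        scaleR_prod_def)
end

text \<open>Complex (Frechet) differentiability; meant for open sets.\<close>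

definition cholomorphic_on ::
  "('a::complex_space \<Rightarrow> 'b::complex_space) \<Rightarrow> 'a set \<Rightarrow> bool" (infixl \<open>cholomorphic'_on\<close> 50) where
  "f cholomorphic_on S \<longleftrightarrow>
     (\<forall>x\<in>S. \<exists>D. (f has_derivative D) (at x within S) \<and> (\<forall>c v. D (cscale c v) = cscale c (D v)))"

lemma cholomorphic_on_iff_holomorphic_on:
  fixes f :: "complex \<Rightarrow> complex"
  shows "f cholomorphic_on S \<longleftrightarrow> f holomorphic_on S"
proof -
  have "(\<exists>D. (f has_derivative D) (at x within S) \<and> (\<forall>c v. D (cscale c v) = cscale c (D v))) \<longleftrightarrow>
        f field_differentiable (at x within S)" for x
  proof
    assume "\<exists>D. (f has_derivative D) (at x within S) \<and> (\<forall>c v. D (cscale c v) = cscale c (D v))"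
    then obtain D where D: "(f has_derivative D) (at x within S)"
        "\<And>c v. D (c * v) = c * D v"
      by (auto simp: cscale_complex_def)
    have "D = (*) (D 1)"
    proof
      show "D v = D 1 * v" for v using D(2)[of v 1] by (simp add: mult.commute)
    qed
    with D show "f field_differentiable (at x within S)"
      by (metis field_differentiable_def has_field_derivative_def)
  next
    assume "f field_differentiable (at x within S)"
    then obtain d where "(f has_derivative (*) d) (at x within S)"
      by (auto simp: field_differentiable_def has_field_derivative_def)
    then show "\<exists>D. (f has_derivative D) (at x within S) \<and> (\<forall>c v. D (cscale c v) = cscale c (D v))"
      by (intro exI[of _ "(*) d"]) (simp add: cscale_complex_def mult.left_commute)
  qed
  then show ?thesis
    by (simp add: cholomorphic_on_def holomorphic_on_def)
qed

text \<open>Maps into a complex manifold given by an atlas, i.e. a set of pairs (domain, chart).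
  On the open set \<open>X\<close>, asking for a whole neighbourhood to be sent into one
  chart domain makes such maps continuous.\<close>

definition holomorphic_into ::
  "('m set \<times> ('m \<Rightarrow> 'b::complex_space)) set \<Rightarrow> ('a::complex_space \<Rightarrow> 'm) \<Rightarrow> 'a set \<Rightarrow> bool" where
  "holomorphic_into A \<phi> X \<longleftrightarrow>
     (\<forall>x\<in>X. \<exists>(U, c)\<in>A. \<exists>W. open W \<and> x \<in> W \<and> W \<subseteq> X \<and> \<phi> ` W \<subseteq> U \<and> (c \<circ> \<phi>) cholomorphic_on W)"


section \<open>The Riemann sphere\<close>

datatype riemann_sphere = Finite complex | Infinity

text \<open>Stereographic projection onto the unit sphere of \<open>complex \<times> real\<close>; the induced metric is
  the chordal metric.\<close>

fun stereo :: "riemann_sphere \<Rightarrow> complex \<times> real" where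
  "stereo (Finite z) =
     (complex_of_real (2 / (1 + (cmod z)\<^sup>2)) * z, ((cmod z)\<^sup>2 - 1) / ((cmod z)\<^sup>2 + 1))"
| "stereo Infinity = (0, 1)"

lemma stereo_inject: "stereo x = stereo y \<Longrightarrow> x = y"
proof -
  have snd_eq: "snd (stereo (Finite z)) = 1 - 2 / (1 + (cmod z)\<^sup>2)" for z
  proof -
    have "1 + (cmod z)\<^sup>2 \<noteq> 0" by (smt (verit) zero_le_power2)
    then show ?thesis by (simp add: field_simps)
  qed
  have pos: "2 / (1 + (cmod z)\<^sup>2) \<noteq> 0" for z
    by (smt (verit) zero_le_power2 divide_eq_0_iff)
  assume eq: "stereo x = stereo y"
  show "x = y"
  proof (cases x)
    case x: (Finite z)
    show ?thesis
    proof (cases y)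
      case y: (Finite w)
      have s: "2 / (1 + (cmod z)\<^sup>2) = 2 / (1 + (cmod w)\<^sup>2)"
        using arg_cong[OF eq, of snd] snd_eq[of z] snd_eq[of w] by (simp add: x y)
      have "complex_of_real (2 / (1 + (cmod z)\<^sup>2)) * z = complex_of_real (2 / (1 + (cmod w)\<^sup>2)) * w"
        using arg_cong[OF eq, of fst] unfolding x y stereo.simps fst_conv .
      then have "complex_of_real (2 / (1 + (cmod w)\<^sup>2)) * z = complex_of_real (2 / (1 + (cmod w)\<^sup>2)) * w"
        unfolding s .
      then have "z = w" using pos[of w] by (metis mult_cancel_left of_real_eq_0_iff)
      then show ?thesis by (simp add: x y)
    next
      case Infinity
      then show ?thesis using arg_cong[OF eq, of snd] snd_eq[of z] pos[of z] by (simp add: x)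
    qed
  next
    case x: Infinity
    show ?thesis
    proof (cases y)
      case (Finite w)
      then show ?thesis using arg_cong[OF eq, of snd] snd_eq[of w] pos[of w] by (simp add: x)
    qed (simp add: x)
  qed
qed

instantiation riemann_sphere :: metric_space
begin
definition dist_riemann_sphere_def: "dist x y = dist (stereo x) (stereo y)"
definition uniformity_riemann_sphere_def:
  "(uniformity :: (riemann_sphere \<times> riemann_sphere) filter) =
     (INF e\<in>{0<..}. principal {(x, y). dist x y < e})"
definition open_riemann_sphere_def:
  "open (U :: riemann_sphere set) \<longleftrightarrow>
     (\<forall>x\<in>U. eventually (\<lambda>(x', y). x' = x \<longrightarrow> y \<in> U) uniformity)"
instance
proof
  fix x y z :: riemann_sphere
  show "dist x y = 0 \<longleftrightarrow> x = y"
    by (auto simp: dist_riemann_sphere_def dest: stereo_inject)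
  show "dist x y \<le> dist x z + dist y z"
    by (simp add: dist_riemann_sphere_def dist_triangle2)
qed (rule uniformity_riemann_sphere_def open_riemann_sphere_def)+
end

fun affine_coord :: "riemann_sphere \<Rightarrow> complex" where
  "affine_coord (Finite z) = z"
| "affine_coord Infinity = 0" \<comment> \<open>irrelevant: outside of the chart domain\<close>

fun infinity_coord :: "riemann_sphere \<Rightarrow> complex" where
  "infinity_coord (Finite z) = 1 / z"
| "infinity_coord Infinity = 0"

definition sphere_atlas :: "(riemann_sphere set \<times> (riemann_sphere \<Rightarrow> complex)) set" where
  "sphere_atlas = {(- {Infinity}, affine_coord), (- {Finite 0}, infinity_coord)}"

definition sphere2_atlas ::
  "((riemann_sphere \<times> riemann_sphere) set \<times> (riemann_sphere \<times> riemann_sphere \<Rightarrow> complex \<times> complex)) set"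
  where
  "sphere2_atlas = {(U \<times> V, map_prod c d) | U c V d. (U, c) \<in> sphere_atlas \<and> (V, d) \<in> sphere_atlas}"


section \<open>The complex projective plane\<close>

quotient_type proj_plane = "complex ^ 3" /
  partial: "\<lambda>x y. x \<noteq> 0 \<and> (\<exists>c. c \<noteq> 0 \<and> y = c *s x)"
  morphisms rep_proj_plane proj_point
proof (rule part_equivpI)
  show "\<exists>x::complex^3. x \<noteq> 0 \<and> (\<exists>c. c \<noteq> 0 \<and> x = c *s x)"
    by (rule exI[of _ "axis 1 1"], rule conjI, simp add: axis_eq_0_iff, rule exI[of _ 1]) simp
  show "symp (\<lambda>x y::complex^3. x \<noteq> 0 \<and> (\<exists>c. c \<noteq> 0 \<and> y = c *s x))"
  proof (rule sympI)
    fix x y :: "complex^3"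
    assume "x \<noteq> 0 \<and> (\<exists>c. c \<noteq> 0 \<and> y = c *s x)"
    then obtain c where c: "x \<noteq> 0" "c \<noteq> 0" "y = c *s x" by blast
    then have "y \<noteq> 0" "x = (1 / c) *s y" "1 / c \<noteq> 0"
      by (auto simp: vector_smult_assoc)
    then show "y \<noteq> 0 \<and> (\<exists>c. c \<noteq> 0 \<and> x = c *s y)" by blast
  qed
  show "transp (\<lambda>x y::complex^3. x \<noteq> 0 \<and> (\<exists>c. c \<noteq> 0 \<and> y = c *s x))"
    by (rule transpI) (metis mult_eq_0_iff vector_smult_assoc)
qed

text \<open>A line is identified with the orthogonal projector onto it, which yields a metric; it induces
  the quotient topology, see \<open>quotient_map_proj_point\<close>.\<close>

lift_definition line_projector :: "proj_plane \<Rightarrow> complex ^ 3 ^ 3" is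
  "\<lambda>x. \<chi> i j. x $ i * cnj (x $ j) / complex_of_real ((norm x)\<^sup>2)"
proof -
  fix x y :: "complex^3"
  assume "x \<noteq> 0 \<and> (\<exists>c. c \<noteq> 0 \<and> y = c *s x)"
  then obtain c where c: "x \<noteq> 0" "c \<noteq> 0" "y = c *s x" by blast
  have "(norm y)\<^sup>2 = (cmod c)\<^sup>2 * (norm x)\<^sup>2"
    by (simp add: c norm_vec_def L2_set_def sum_nonneg norm_mult power_mult_distrib sum_distrib_left)
  then have n: "complex_of_real ((norm y)\<^sup>2) = (c * cnj c) * complex_of_real ((norm x)\<^sup>2)"
    by (simp only: of_real_mult complex_norm_square)
  show "(\<chi> i j. x $ i * cnj (x $ j) / complex_of_real ((norm x)\<^sup>2)) =
        (\<chi> i j. y $ i * cnj (y $ j) / complex_of_real ((norm y)\<^sup>2))"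
    unfolding n using c by (simp add: vec_eq_iff field_simps)
qed

lemma line_projector_inject: "line_projector p = line_projector q \<Longrightarrow> p = q"
proof transfer
  fix x y :: "complex^3"
  assume eq: "(\<chi> i j. x $ i * cnj (x $ j) / complex_of_real ((norm x)\<^sup>2)) =
              (\<chi> i j. y $ i * cnj (y $ j) / complex_of_real ((norm y)\<^sup>2))"
    and "x \<noteq> 0 \<and> (\<exists>c. c \<noteq> 0 \<and> x = c *s x)" "y \<noteq> 0 \<and> (\<exists>c. c \<noteq> 0 \<and> y = c *s y)"
  then have "x \<noteq> 0" "y \<noteq> 0" by blast+
  have e: "x $ i * cnj (x $ j) / complex_of_real ((norm x)\<^sup>2) =
           y $ i * cnj (y $ j) / complex_of_real ((norm y)\<^sup>2)" for i j
    using eq by (simp add: vec_eq_iff)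
  obtain j where j: "y $ j \<noteq> 0" using \<open>y \<noteq> 0\<close> by (auto simp: vec_eq_iff)
  have "x $ j \<noteq> 0" using e[of j j] j \<open>y \<noteq> 0\<close> by auto
  define c where "c = cnj (x $ j) / complex_of_real ((norm x)\<^sup>2) /
                      (cnj (y $ j) / complex_of_real ((norm y)\<^sup>2))"
  have "c \<noteq> 0" using \<open>x $ j \<noteq> 0\<close> j \<open>x \<noteq> 0\<close> \<open>y \<noteq> 0\<close> by (simp add: c_def)
  moreover have "y = c *s x"
    using e[of _ j] j \<open>x \<noteq> 0\<close> \<open>y \<noteq> 0\<close> by (simp add: vec_eq_iff c_def field_simps)
  ultimately show "x \<noteq> 0 \<and> (\<exists>c. c \<noteq> 0 \<and> y = c *s x)" using \<open>x \<noteq> 0\<close> by blast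
qed

instantiation proj_plane :: metric_space
begin
definition dist_proj_plane_def: "dist x y = dist (line_projector x) (line_projector y)"
definition uniformity_proj_plane_def:
  "(uniformity :: (proj_plane \<times> proj_plane) filter) =
     (INF e\<in>{0<..}. principal {(x, y). dist x y < e})"
definition open_proj_plane_def:
  "open (U :: proj_plane set) \<longleftrightarrow>
     (\<forall>x\<in>U. eventually (\<lambda>(x', y). x' = x \<longrightarrow> y \<in> U) uniformity)"
instance
proof
  fix x y z :: proj_plane
  show "dist x y = 0 \<longleftrightarrow> x = y"
    by (auto simp: dist_proj_plane_def dest: line_projector_inject)
  show "dist x y \<le> dist x z + dist y z"
    by (simp add: dist_proj_plane_def dist_triangle2)
qed (rule uniformity_proj_plane_def open_proj_plane_def)+
end

lemma quotient_map_proj_point: "quotient_map (top_of_set (- {0})) euclidean proj_point"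
proof -
  have lp: "line_projector (proj_point x) =
              (\<chi> i j. x $ i * cnj (x $ j) / complex_of_real ((norm x)\<^sup>2))"
    if "x \<noteq> 0" for x
    by (rule line_projector.abs_eq) (use that in \<open>auto intro!: exI[of _ 1]\<close>)
  have "continuous_on (- {0})
          (\<lambda>x::complex^3. \<chi> i j. x $ i * cnj (x $ j) / complex_of_real ((norm x)\<^sup>2))"
    by (intro continuous_intros) auto
  then have "continuous_on (- {0}) (\<lambda>x. line_projector (proj_point x))"
    by (rule continuous_on_eq) (simp add: lp)
  then have cont: "continuous_on (- {0}) proj_point"
    by (simp add: continuous_on_iff dist_proj_plane_def)
  have unit: "\<exists>x. norm x = 1 \<and> proj_point x = P" for P
  proof -
    have "\<exists>x. P = proj_point x \<and> x \<noteq> 0"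
      by (induct P rule: proj_plane.abs_induct) auto
    then obtain x where x: "P = proj_point x" "x \<noteq> 0" by blast
    define c where "c = complex_of_real (1 / norm x)"
    have c: "c *s x = (1 / norm x) *\<^sub>R x"
      by (simp add: c_def vec_eq_iff scaleR_conv_of_real[where 'a = complex])
    have "c \<noteq> 0" using x by (simp add: c_def)
    then have "P = proj_point (c *s x)"
      using x by (auto intro!: Quotient3_rel_abs[OF Quotient3_proj_plane] exI[of _ c])
    moreover have "norm (c *s x) = 1" using x by (simp add: c)
    ultimately show ?thesis by metis
  qed
  have "open {x \<in> - {0}. proj_point x \<in> U} \<longleftrightarrow> open U" for U
  proof
    assume U: "open {x \<in> - {0}. proj_point x \<in> U}"
    have "compact (sphere 0 1 - {x \<in> - {0}. proj_point x \<in> U})"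
      using U by (intro compact_diff) auto
    moreover have "sphere 0 1 - {x \<in> - {0}. proj_point x \<in> U} \<subseteq> - {0}" by auto
    ultimately have "compact (proj_point ` (sphere 0 1 - {x \<in> - {0}. proj_point x \<in> U}))"
      by (meson compact_continuous_image cont continuous_on_subset)
    moreover have "proj_point ` (sphere 0 1 - {x \<in> - {0}. proj_point x \<in> U}) = - U"
    proof (intro set_eqI iffI)
      fix P assume "P \<in> - U"
      then show "P \<in> proj_point ` (sphere 0 1 - {x \<in> - {0}. proj_point x \<in> U})"
        using unit[of P] by auto
    qed auto
    ultimately show "open U"
      by (simp add: compact_imp_closed open_closed)
  next
    assume "open U"
    then show "open {x \<in> - {0}. proj_point x \<in> U}"
      using continuous_open_preimage[OF cont _ \<open>open U\<close>]
      by (simp add: open_Compl vimage_def Int_def)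
  qed
  moreover have "proj_point ` (- {0}) = UNIV"
  proof (intro set_eqI iffI UNIV_I)
    show "P \<in> proj_point ` (- {0})" for P
      using unit[of P] by (metis ComplI imageI norm_zero singletonD zero_neq_one)
  qed
  ultimately show ?thesis
    by (auto simp: quotient_map_def openin_open_eq open_Compl)
qed

lift_definition nonzero_coord :: "3 \<Rightarrow> proj_plane \<Rightarrow> bool" is "\<lambda>i x. x $ i \<noteq> 0"
  by auto

lift_definition coord_ratio :: "3 \<Rightarrow> 3 \<Rightarrow> proj_plane \<Rightarrow> complex" is "\<lambda>i j x. x $ j / x $ i"
  by auto

definition proj_atlas :: "(proj_plane set \<times> (proj_plane \<Rightarrow> complex \<times> complex)) set" where
  "proj_atlas =
     {({P. nonzero_coord i P}, \<lambda>P. (coord_ratio i j P, coord_ratio i k P)) | i j k. {i, j, k} = UNIV}"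

definition proj_embed :: "complex \<times> complex \<Rightarrow> proj_plane" where
  "proj_embed = (\<lambda>(z, w). proj_point (vector [z, w, 1]))"


section \<open>Normality and Fatou sets\<close>

definition converges_on_compacts ::
  "'a::topological_space set \<Rightarrow> (nat \<Rightarrow> 'a \<Rightarrow> 'b::metric_space) \<Rightarrow> ('a \<Rightarrow> 'b) \<Rightarrow> bool" where
  "converges_on_compacts X \<phi> l \<longleftrightarrow>
     (\<forall>K. compact K \<and> K \<subseteq> X \<longrightarrow> uniform_limit K \<phi> l sequentially)"

definition diverges_on_compacts ::
  "'a::topological_space set \<Rightarrow> (nat \<Rightarrow> 'a \<Rightarrow> 'b::real_normed_vector) \<Rightarrow> bool" where
  "diverges_on_compacts X \<phi> \<longleftrightarrow>
     (\<forall>K. compact K \<and> K \<subseteq> X \<longrightarrow> (\<forall>R. \<forall>\<^sub>F n in sequentially. \<forall>x\<in>K. norm (\<phi> n x) > R))"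

definition compactified_normal ::
  "'a::complex_space set \<Rightarrow> ('a \<Rightarrow> complex \<times> complex) set \<Rightarrow> bool" where
  "compactified_normal X \<F> \<longleftrightarrow>
     (\<forall>\<phi>::nat \<Rightarrow> 'a \<Rightarrow> complex \<times> complex. range \<phi> \<subseteq> \<F> \<longrightarrow>
        diverges_on_compacts X \<phi> \<or>
        (\<exists>r l. strict_mono r \<and> l cholomorphic_on X \<and> converges_on_compacts X (\<phi> \<circ> r) l))"

definition atlas_normal ::
  "('m set \<times> ('m::metric_space \<Rightarrow> 'b::complex_space)) set \<Rightarrow> 'a::complex_space set \<Rightarrow>
     ('a \<Rightarrow> 'm) set \<Rightarrow> bool" where
  "atlas_normal A X \<F> \<longleftrightarrow>
     (\<forall>\<phi>::nat \<Rightarrow> 'a \<Rightarrow> 'm. range \<phi> \<subseteq> \<F> \<longrightarrow>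
        (\<exists>r l. strict_mono r \<and> holomorphic_into A l X \<and> converges_on_compacts X (\<phi> \<circ> r) l))"

definition sphere_normal :: "'a::complex_space set \<Rightarrow> ('a \<Rightarrow> complex) set \<Rightarrow> bool" where
  "sphere_normal X \<F> \<longleftrightarrow> atlas_normal sphere_atlas X ((\<lambda>u. Finite \<circ> u) ` \<F>)"

definition proj_normal :: "'a::complex_space set \<Rightarrow> ('a \<Rightarrow> complex \<times> complex) set \<Rightarrow> bool" where
  "proj_normal X \<F> \<longleftrightarrow> atlas_normal proj_atlas X ((\<lambda>u. proj_embed \<circ> u) ` \<F>)"

definition sphere2_normal :: "'a::complex_space set \<Rightarrow> ('a \<Rightarrow> complex \<times> complex) set \<Rightarrow> bool" where
  "sphere2_normal X \<F> \<longleftrightarrow> atlas_normal sphere2_atlas X ((\<lambda>u. map_prod Finite Finite \<circ> u) ` \<F>)"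

definition fatou_set ::
  "('a::topological_space set \<Rightarrow> ('a \<Rightarrow> 'a) set \<Rightarrow> bool) \<Rightarrow> ('a \<Rightarrow> 'a) \<Rightarrow> 'a set" where
  "fatou_set normal F = {x. \<exists>V. open V \<and> x \<in> V \<and> normal V (range (\<lambda>n. F ^^ n))}"

definition fatou_component :: "(complex \<Rightarrow> complex) \<Rightarrow> complex \<Rightarrow> complex set" where
  "fatou_component f z = connected_component_set (fatou_set sphere_normal f) z"

definition attracting_fixed_point :: "(complex \<Rightarrow> complex) \<Rightarrow> complex \<Rightarrow> bool" where
  "attracting_fixed_point u c \<longleftrightarrow> u c = c \<and> cmod (deriv u c) < 1"

end

theory Submission
  imports Defs "HOL-Complex_Analysis.Great_Picard"
begin

text \<open>Write \<open>q z = z + p z\<close>, so that \<open>f\<^sup>n = q\<^sup>n + n T\<close> by periodicity. Near \<open>(z, 0)\<close> with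
  \<open>z\<close> in the basin of \<open>z\<^sub>0\<close> for \<open>q\<close>, the orbit of \<open>F\<close> eventually enters the disk about
  \<open>z\<^sub>0 + N T\<close>, where \<open>q\<close> contracts and the remaining perturbations have small total size. Hence its
  first coordinate stays close to \<open>z\<^sub>0 + n T\<close> and escapes, its second tends to \<open>0\<close>, both uniformly,
  which gives normality in all three senses.

  That \<open>U\<^sub>0\<close> lies in the basin rests on a classical fact: \<open>f \<circ> f\<close> has a fixed
  point unless \<open>f\<close> is a translation. Its translates by multiples of \<open>T\<close> provide values that \<open>q\<^sup>n\<close> must
  omit near any point of \<open>U\<^sub>0\<close> in the closure of the basin.\<close>

section \<open>Dynamics of entire functions\<close>

lemma holomorphic_funpow:
  assumes "u holomorphic_on UNIV"
  shows "(u ^^ n) holomorphic_on (UNIV :: complex set)"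
proof (induction n)
  case (Suc n)
  then show ?case
    unfolding funpow.simps using assms
    by (intro holomorphic_on_compose) (auto intro: holomorphic_on_subset)
qed (simp add: id_def)

lemma periodic_of_nat:
  fixes p :: "complex \<Rightarrow> 'a"
  assumes per: "\<And>z. p (z + T) = p z"
  shows "p (z + of_nat n * T) = p z"
proof (induction n)
  case (Suc n)
  then show ?case using per[of "z + of_nat n * T"] by (simp add: algebra_simps)
qed simp

lemma funpow_translate:
  fixes p :: "complex \<Rightarrow> complex"
  assumes per: "\<And>z. p (z + T) = p z"
  shows "((\<lambda>z. z + T + p z) ^^ n) z = ((\<lambda>z. z + p z) ^^ n) z + of_nat n * T"
proof (induction n)
  case (Suc n)
  then have "((\<lambda>z. z + T + p z) ^^ Suc n) z =
      (((\<lambda>z. z + p z) ^^ n) z + of_nat n * T) + T + p (((\<lambda>z. z + p z) ^^ n) z + of_nat n * T)"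
    by (simp only: funpow.simps o_def)
  also have "\<dots> = ((\<lambda>z. z + p z) ^^ Suc n) z + of_nat (Suc n) * T"
    unfolding periodic_of_nat[of p T, OF per] by (simp add: algebra_simps)
  finally show ?case .
qed simp

section \<open>Points of period at most two\<close>

text \<open>Two applications of little Picard, to (f(f z) - z)/(f z - z) and to f' o f, force a map
  whose second iterate has no fixed point to be affine, and an affine map without fixed points is a
  translation.\<close>

lemma entire_comp_self_has_fixpoint:
  assumes hol: "f holomorphic_on UNIV" and ntrans: "\<nexists>c. f = (\<lambda>z. z + c)"
  obtains \<zeta> :: complex where "f (f \<zeta>) = \<zeta>"
proof (rule ccontr)
  assume contr: "\<not> thesis"
  then have nofix2: "f (f z) \<noteq> z" for z
    using that by blast
  then have nofix: "f z \<noteq> z" for z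
    by metis
  have hol2: "(\<lambda>z. f (f z)) holomorphic_on UNIV"
    using holomorphic_on_compose[of f UNIV f] hol
    by (auto simp: o_def intro: holomorphic_on_subset)
  obtain c where c: "(\<lambda>z. (f (f z) - z) / (f z - z)) = (\<lambda>_. c)"
  proof (rule little_Picard)
    show "(\<lambda>z. (f (f z) - z) / (f z - z)) holomorphic_on UNIV"
      using nofix by (intro holomorphic_intros hol hol2) auto
    \<comment> \<open>The value 0 would make z a fixed point of f o f, the value 1 would make f z a
      fixed point of f.\<close>
    have "(f (f z) - z) / (f z - z) \<noteq> 0" "(f (f z) - z) / (f z - z) \<noteq> 1" for z
      using nofix[of z] nofix[of "f z"] nofix2[of z] by simp_all
    then show "range (\<lambda>z. (f (f z) - z) / (f z - z)) \<inter> {0, 1} = {}"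
      by blast
  qed auto
  have c': "f (f z) - z = c * (f z - z)" for z
    using fun_cong[OF c, of z] nofix[of z] by (simp add: field_simps)
  have "c \<noteq> 1"
    using c'[of 0] nofix[of "f 0"] by auto
  have "c \<noteq> 0"
    using c'[of 0] nofix2[of 0] by auto
  have der: "(f has_field_derivative deriv f z) (at z)" for z
    using hol holomorphic_derivI by blast
  \<comment> \<open>Differentiating \<open>c'\<close> and collecting terms; as the right-hand side
    is nonzero, neither factor on the left vanishes.\<close>
  have eq: "deriv f z * (deriv f (f z) - c) = 1 - c" for z
  proof -
    have "((\<lambda>z. f (f z) - z) has_field_derivative deriv f (f z) * deriv f z - 1) (at z)"
      by (intro derivative_intros DERIV_chain2[OF der der])
    moreover have "((\<lambda>z. c * (f z - z)) has_field_derivative c * (deriv f z - 1)) (at z)"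
      by (rule derivative_eq_intros der refl | simp)+
    ultimately have "deriv f (f z) * deriv f z - 1 = c * (deriv f z - 1)"
      using DERIV_unique c' by (metis (no_types, lifting) ext)
    then show ?thesis
      by (simp add: algebra_simps)
  qed
  have holf': "deriv f holomorphic_on UNIV"
    by (intro holomorphic_deriv hol) auto
  obtain d where d: "(\<lambda>z. deriv f (f z)) = (\<lambda>_. d)"
  proof (rule little_Picard)
    show "(\<lambda>z. deriv f (f z)) holomorphic_on UNIV"
      using holomorphic_on_compose[of f UNIV "deriv f"] hol holf'
      by (auto simp: o_def intro: holomorphic_on_subset)
    \<comment> \<open>\<open>eq\<close> at \<open>z\<close> excludes the value c; at
      \<open>f z\<close> the first factor is \<open>deriv f (f z)\<close>, which excludes 0.\<close>
    have "deriv f (f z) \<noteq> c" "deriv f (f z) \<noteq> 0" for z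
      using eq[of z] eq[of "f z"] \<open>c \<noteq> 1\<close> by auto
    then show "range (\<lambda>z. deriv f (f z)) \<inter> {c, 0} = {}"
      by auto
  qed (use \<open>c \<noteq> 0\<close> in auto)
  \<comment> \<open>Once f' o f is the constant d, \<open>eq\<close> determines f', so f is affine
    with slope e.\<close>
  define e where "e = (1 - c) / (d - c)"
  have "deriv f z = e" for z
  proof -
    have *: "deriv f z * (d - c) = 1 - c"
      using eq[of z] fun_cong[OF d, of z] by simp
    then have "d - c \<noteq> 0"
      using \<open>c \<noteq> 1\<close> by auto
    with * show ?thesis
      unfolding e_def by (rule nonzero_eq_divide_eq[THEN iffD2, rotated])
  qed
  then have "((\<lambda>z. f z - e * z) has_field_derivative 0) (at z)" for z
    using der[of z] by (auto intro!: derivative_eq_intros)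
  then obtain k where "f z - e * z = k" for z
    using has_field_derivative_zero_constant[of UNIV "\<lambda>z. f z - e * z"] by auto
  then have fe: "f z = e * z + k" for z
    by (metis diff_add_cancel add.commute)
  show False
  proof (cases "e = 1")
    case True
    then have "f = (\<lambda>z. z + k)" using fe by auto
    then show False using ntrans by blast
  next
    case False
    then have "f (k / (1 - e)) = k / (1 - e)"
      unfolding fe by (simp add: field_simps)
    then show False using nofix by blast
  qed
qed

text \<open>The chart \<^term>\<open>infinity_coord\<close> turns this into the identity theorem, applied in each
  chart neighbourhood.\<close>

lemma holomorphic_into_sphere_eq_Infinity:
  assumes hol: "holomorphic_into sphere_atlas l X"
    and S: "connected S" "S \<subseteq> X"
    and B: "open B" "B \<subseteq> S" "B \<noteq> {}" "\<And>x. x \<in> B \<Longrightarrow> l x = Infinity"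
    and "x \<in> S"
  shows "l (x :: complex) = Infinity"
proof -
  define E where "E = interior {x. l x = Infinity}"
  \<comment> \<open>\<open>E\<close> is relatively closed in \<open>X\<close>. Near a point of its
    closure the chart domain contains \<open>Infinity\<close>, so the chart is
    \<open>infinity_coord\<close>, and it vanishes on an open part of a ball, hence on the whole
    ball.\<close>
  have key: "y \<in> E" if "y \<in> X" "y \<in> closure E" for y
  proof -
    obtain U c W where UcW: "(U, c) \<in> sphere_atlas" "open W" "y \<in> W" "W \<subseteq> X" "l ` W \<subseteq> U"
      "(c \<circ> l) cholomorphic_on W"
      using hol \<open>y \<in> X\<close> unfolding holomorphic_into_def by fast
    obtain e where e: "e > 0" "ball y e \<subseteq> W"
      using UcW openE by blast
    have op: "open (ball y e \<inter> E)"
      by (auto simp: E_def)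
    moreover have ne: "ball y e \<inter> E \<noteq> {}"
      using that(2) e(1) by (simp add: closure_iff_nhds_not_empty)
        (metis Int_commute centre_in_ball open_ball subset_refl)
    then obtain b where b: "b \<in> ball y e" "b \<in> E" by blast
    then have "l b = Infinity"
      using interior_subset by (auto simp: E_def)
    moreover have "l b \<in> U"
      using b e UcW(5) by blast
    ultimately have Uc: "U = - {Finite 0}" "c = infinity_coord"
      using UcW(1) by (simp_all add: sphere_atlas_def) blast+
    have "(c \<circ> l) holomorphic_on ball y e"
      using UcW(6) e(2) cholomorphic_on_iff_holomorphic_on holomorphic_on_subset by blast
    moreover have "(c \<circ> l) z = 0" if "z \<in> ball y e \<inter> E" for z
      using that interior_subset[of "{x. l x = Infinity}"] by (auto simp: E_def Uc)
    ultimately have zero: "(c \<circ> l) z = 0" if "z \<in> ball y e" for z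
      using analytic_continuation_open[of "ball y e \<inter> E" "ball y e" "c \<circ> l" "\<lambda>_. 0" z]
        op ne that by auto
    \<comment> \<open>Since 1 / 0 = 0, a zero of \<open>infinity_coord\<close> could also be
      \<open>Finite 0\<close>; the chart domain excludes that point.\<close>
    have "l z = Infinity" if "z \<in> ball y e" for z
    proof (cases "l z")
      case (Finite a)
      moreover have "l z \<noteq> Finite 0"
        using that e(2) UcW(5) Uc by blast
      ultimately show ?thesis
        using zero[OF that] by (simp add: Uc)
    qed
    then show "y \<in> E"
      unfolding E_def by (intro interiorI[of "ball y e"]) (use e in auto)
  qed
  have "S \<inter> E = S"
  proof -
    have "openin (top_of_set S) (S \<inter> E)"
      by (auto simp: E_def)
    moreover have "S \<inter> E = S \<inter> closure E"
      using key S closure_subset by blast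
    then have "closedin (top_of_set S) (S \<inter> E)"
      by (metis closed_closure closedin_closed_Int)
    moreover have "S \<inter> E \<noteq> {}"
      using B interiorI[of B _ "{x. l x = Infinity}"] by (fastforce simp: E_def)
    ultimately show ?thesis
      using S(1) unfolding connected_clopen by blast
  qed
  then show ?thesis
    using \<open>x \<in> S\<close> interior_subset by (fastforce simp: E_def)
qed

section \<open>Basins of attracting fixed points\<close>

text \<open>The difference quotient at c tends to |u'(c)| in modulus, so near c it stays below the
  midpoint of |u'(c)| and 1, which serves as \<mu>.\<close>

lemma attracting_fixed_point_contraction:
  assumes hol: "u holomorphic_on UNIV" and att: "attracting_fixed_point u c"
  obtains r \<mu> where "0 < r" "0 \<le> \<mu>" "\<mu> < 1" "\<And>z. z \<in> cball c r \<Longrightarrow> dist (u z) c \<le> \<mu> * dist z c"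
proof -
  define \<mu> where "\<mu> = (1 + cmod (deriv u c)) / 2"
  have uc: "u c = c" and d: "cmod (deriv u c) < \<mu>" and \<mu>: "0 \<le> \<mu>" "\<mu> < 1"
    using att by (auto simp: attracting_fixed_point_def \<mu>_def)
  have "(u has_field_derivative deriv u c) (at c)"
    using hol holomorphic_derivI by blast
  then have "((\<lambda>z. cmod ((u z - u c) / (z - c))) \<longlongrightarrow> cmod (deriv u c)) (at c)"
    unfolding has_field_derivative_iff by (rule tendsto_norm)
  then have "\<forall>\<^sub>F z in at c. cmod ((u z - u c) / (z - c)) < \<mu>"
    using d by (rule order_tendstoD)
  then obtain e where e: "e > 0"
    "\<And>z. z \<noteq> c \<Longrightarrow> dist z c < e \<Longrightarrow> cmod ((u z - u c) / (z - c)) < \<mu>"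
    by (auto simp: eventually_at)
  show ?thesis
  proof (rule that[of "e / 2" \<mu>])
    fix z assume z: "z \<in> cball c (e / 2)"
    show "dist (u z) c \<le> \<mu> * dist z c"
    proof (cases "z = c")
      case False
      have "cmod ((u z - u c) / (z - c)) < \<mu>"
        using z e(1) False by (intro e(2)) (auto simp: dist_commute)
      then show ?thesis
        using False by (simp add: dist_norm norm_divide field_simps uc)
    qed (simp add: uc)
  qed (use e \<mu> in auto)
qed

lemma contraction_funpow:
  assumes "0 \<le> \<mu>" "\<mu> < 1" and u: "\<And>z. z \<in> cball c r \<Longrightarrow> dist (u z) c \<le> \<mu> * dist z c"
    and z: "z \<in> cball c r"
  shows "dist ((u ^^ n) z) c \<le> \<mu> ^ n * dist z c"
proof (induction n)
  case (Suc n)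
  have "\<mu> ^ n * dist z c \<le> dist z c"
    using assms by (simp add: mult_left_le_one_le power_le_one)
  with Suc z have "(u ^^ n) z \<in> cball c r"
    by (auto simp: dist_commute)
  from u[OF this] have "dist ((u ^^ Suc n) z) c \<le> \<mu> * dist ((u ^^ n) z) c"
    by simp
  also have "\<dots> \<le> \<mu> * (\<mu> ^ n * dist z c)"
    using Suc assms(1) by (rule mult_left_mono)
  finally show ?case by (simp add: mult.assoc)
qed simp

text \<open>The whole basin of attraction, not only the component around \<open>c\<close>.\<close>

definition basin :: "(complex \<Rightarrow> complex) \<Rightarrow> complex \<Rightarrow> complex set" where
  "basin u c = {z. (\<lambda>n. (u ^^ n) z) \<longlonglongrightarrow> c}"

text \<open>A single visit to the disk where u contracts already forces convergence to c. So the
  basin is a union of open preimages, and convergence along a subsequence is enough to lie in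
  it.\<close>

lemma basin_eq_UN_vimage:
  assumes hol: "u holomorphic_on UNIV" and att: "attracting_fixed_point u c"
  obtains r where "r > 0" "basin u c = (\<Union>n. (u ^^ n) -` ball c r)"
proof -
  obtain r \<mu> where r: "0 < r" "0 \<le> \<mu>" "\<mu> < 1" "\<And>z. z \<in> cball c r \<Longrightarrow> dist (u z) c \<le> \<mu> * dist z c"
    using attracting_fixed_point_contraction[OF assms] by metis
  have "z \<in> basin u c" if "(u ^^ n) z \<in> ball c r" for n z
  proof -
    have "dist ((u ^^ k) ((u ^^ n) z)) c \<le> \<mu> ^ k * dist ((u ^^ n) z) c" for k
      using that r by (intro contraction_funpow[of \<mu> c r]) auto
    moreover have "(\<lambda>k. \<mu> ^ k * dist ((u ^^ n) z) c) \<longlonglongrightarrow> 0"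
      using r by (intro tendsto_mult_left_zero LIMSEQ_power_zero) auto
    ultimately have "(\<lambda>k. dist ((u ^^ k) ((u ^^ n) z)) c) \<longlonglongrightarrow> 0"
      using tendsto_sandwich[of "\<lambda>_. 0" "\<lambda>k. dist ((u ^^ k) ((u ^^ n) z)) c" sequentially
          "\<lambda>k. \<mu> ^ k * dist ((u ^^ n) z) c"] by simp
    then have "(\<lambda>k. (u ^^ (k + n)) z) \<longlonglongrightarrow> c"
      by (subst tendsto_dist_iff) (simp add: funpow_add)
    then show ?thesis
      unfolding basin_def by (auto dest: LIMSEQ_offset)
  qed
  moreover have "\<exists>n. (u ^^ n) z \<in> ball c r" if "z \<in> basin u c" for z
    using that r(1) unfolding basin_def lim_sequentially
    by (auto simp: dist_commute)
  ultimately show ?thesis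
    using r(1) by (intro that[of r]) auto
qed

lemma open_basin:
  assumes hol: "u holomorphic_on UNIV" and att: "attracting_fixed_point u c"
  shows "open (basin u c)"
proof -
  have "continuous_on UNIV (u ^^ n)" for n
    using holomorphic_funpow[OF hol] holomorphic_on_imp_continuous_on by blast
  then have "open (\<Union>n. (u ^^ n) -` ball c r)" for r
    by (intro open_UN ballI open_vimage) auto
  then show ?thesis
    using basin_eq_UN_vimage[OF assms] by metis
qed

section \<open>The plane inside the Riemann sphere\<close>

text \<open>Both components of the stereographic projection differ from those of the pole by at most
  2/|z| as soon as |z| \<ge> 1.\<close>

lemma tendsto_Finite_Infinity: "((\<lambda>z. Finite z) \<longlongrightarrow> Infinity) at_infinity"
proof -
  have lim: "((\<lambda>z::complex. 2 * inverse (cmod z) + 2 * inverse (cmod z)) \<longlongrightarrow> 2 * 0 + 2 * 0) at_infinity"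
    by (intro tendsto_intros tendsto_inverse_0_at_top filterlim_at_infinity_imp_norm_at_top filterlim_ident)
  have "\<forall>\<^sub>F z in at_infinity. norm (dist (Finite z) Infinity) \<le> 2 * inverse (cmod z) + 2 * inverse (cmod z)"
    unfolding eventually_at_infinity
  proof (intro exI[of _ 1] allI impI)
    fix z :: complex assume z: "1 \<le> cmod z"
    have pos: "1 + (cmod z)\<^sup>2 > 0"
      by (simp add: add_pos_nonneg)
    have sq: "cmod z \<le> (cmod z)\<^sup>2"
      using z by (simp add: self_le_power)
    have "dist (Finite z) Infinity = norm (stereo (Finite z) - (0, 1))"
      by (simp add: dist_riemann_sphere_def dist_norm)
    also have "\<dots> \<le> norm (complex_of_real (2 / (1 + (cmod z)\<^sup>2)) * z) +
        norm (((cmod z)\<^sup>2 - 1) / ((cmod z)\<^sup>2 + 1) - 1)"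
      unfolding stereo.simps minus_prod_def fst_conv snd_conv diff_zero
      by (rule norm_Pair_le)
    also have "norm (complex_of_real (2 / (1 + (cmod z)\<^sup>2)) * z) \<le> 2 * inverse (cmod z)"
    proof -
      have "norm (complex_of_real (2 / (1 + (cmod z)\<^sup>2)) * z) = 2 / (1 + (cmod z)\<^sup>2) * cmod z"
        using pos by (subst norm_mult, subst norm_of_real) simp
      also have "\<dots> \<le> 2 / (cmod z)\<^sup>2 * cmod z"
        using pos z by (intro mult_right_mono divide_left_mono mult_pos_pos zero_less_power) auto
      also have "\<dots> = 2 * inverse (cmod z)"
      proof -
        have "cmod z \<noteq> 0" using z by linarith
        then show ?thesis
          by (simp add: power2_eq_square inverse_eq_divide)
      qed
      finally show ?thesis .
    qed
    also have "norm (((cmod z)\<^sup>2 - 1) / ((cmod z)\<^sup>2 + 1) - 1) \<le> 2 * inverse (cmod z)"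
    proof -
      have "((cmod z)\<^sup>2 - 1) / ((cmod z)\<^sup>2 + 1) - 1 = - 2 / (1 + (cmod z)\<^sup>2)"
        using pos by (simp add: field_simps)
      also have "norm \<dots> = 2 / (1 + (cmod z)\<^sup>2)"
        using pos by simp
      also have "\<dots> \<le> 2 / cmod z"
        using sq z by (intro divide_left_mono mult_pos_pos pos) auto
      finally show ?thesis by (simp add: divide_inverse)
    qed
    finally show "norm (dist (Finite z) Infinity) \<le> 2 * inverse (cmod z) + 2 * inverse (cmod z)"
      by simp
  qed
  then have "((\<lambda>z. dist (Finite z) Infinity) \<longlongrightarrow> 0) at_infinity"
    by (rule Lim_null_comparison) (use lim in simp)
  then show ?thesis
    by (subst tendsto_dist_iff)
qed

lemma isCont_Finite: "isCont Finite z"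
proof -
  have "isCont (\<lambda>z. stereo (Finite z)) z"
    unfolding stereo.simps
    by (intro continuous_intros isCont_o2[of _ _ of_real] allI)
      (smt (verit, best) zero_le_power2)+
  then show ?thesis
    unfolding isCont_def dist_riemann_sphere_def
    by (subst tendsto_dist_iff, subst (asm) tendsto_dist_iff) (simp add: dist_riemann_sphere_def)
qed

lemma converges_on_compacts_imp_tendsto:
  assumes "converges_on_compacts X \<phi> l" "x \<in> X"
  shows "(\<lambda>n. \<phi> n x) \<longlonglongrightarrow> l x"
  using assms(1)[unfolded converges_on_compacts_def, rule_format, of "{x}"] assms(2)
    tendsto_uniform_limitI[where S = "{x}" and F = sequentially] by simp

section \<open>Holomorphic sequences omitting two values\<close>

text \<open>A statement of Vitali type: boundedness at \<open>a\<close> and two omitted values give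
  local bounds by Schottky, Montel extracts a subsequence converging on the ball, and its limit is
  \<open>L\<close> near \<open>a\<close>, hence on the whole ball by the identity theorem.\<close>

lemma holomorphic_seq_tendsto_continuation:
  fixes u :: "nat \<Rightarrow> complex \<Rightarrow> complex"
  assumes hol: "\<And>n. u n holomorphic_on ball a r"
    and omit: "\<And>n x. x \<in> ball a r \<Longrightarrow> u n x \<noteq> b \<and> u n x \<noteq> c" and "b \<noteq> c"
    and B: "open B" "a \<in> B" and lim: "\<And>x. x \<in> B \<Longrightarrow> (\<lambda>n. u n x) \<longlonglongrightarrow> L"
    and z: "z \<in> ball a r"
  obtains k where "strict_mono k" "(\<lambda>n. u (k n) z) \<longlonglongrightarrow> L"
proof -
  have "convergent (\<lambda>n. u n a)"
    using lim[OF B(2)] by (auto simp: convergent_def)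
  then obtain M where M: "\<And>n. cmod (u n a) \<le> M"
    using convergent_imp_Bseq Bseq_def by metis
  \<comment> \<open>The affine change takes the omitted values b and c to 0 and 1, as in Schottky's
    theorem; \<open>R\<close> then bounds \<open>v n\<close> at the centre.\<close>
  define v where "v n x = (u n x - b) / (c - b)" for n x
  define R where "R = (M + cmod b) / cmod (c - b)"
  \<comment> \<open>Schottky's theorem concerns the closed unit disk. It is applied, after
    rescaling, to the disk of radius \<open>s\<close> about \<open>a\<close>; \<open>s < r\<close>
    keeps this closed disk inside the ball, and \<open>t < s\<close> keeps \<open>x\<close> away
    from its boundary.\<close>
  have bound: "cmod (v n x) \<le> exp (pi * exp (pi * (2 + 2 * R + 12 * (t / s) / (1 - t / s))))"
    if "0 < t" "t < s" "s < r" "dist a x \<le> t" for n x t s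
  proof -
    have s: "a + of_real s * y \<in> ball a r" if "y \<in> cball 0 1" for y
    proof -
      have "s * cmod y \<le> s * 1"
        using that \<open>0 < t\<close> \<open>t < s\<close> by (intro mult_left_mono) auto
      then have "s * cmod y < r"
        using \<open>s < r\<close> by linarith
      then show ?thesis
        using \<open>0 < t\<close> \<open>t < s\<close> by (simp add: dist_norm norm_mult)
    qed
    have "cmod (v n (a + of_real s * ((x - a) / of_real s)))
        \<le> exp (pi * exp (pi * (2 + 2 * R + 12 * (t / s) / (1 - t / s))))"
    proof (rule Schottky[where f = "\<lambda>y. v n (a + of_real s * y)"])
      have "u n \<circ> (\<lambda>y. a + of_real s * y) holomorphic_on cball 0 1"
        using s by (intro holomorphic_on_compose holomorphic_intros holomorphic_on_subset[OF hol]) auto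
      then show "(\<lambda>y. v n (a + of_real s * y)) holomorphic_on cball 0 1"
        using \<open>b \<noteq> c\<close> by (auto simp: v_def o_def intro!: holomorphic_intros)
      have "cmod (u n a - b) \<le> M + cmod b"
        using M[of n] norm_triangle_ineq4[of "u n a" b] by linarith
      then show "cmod (v n (a + of_real s * 0)) \<le> R"
        using \<open>b \<noteq> c\<close> by (simp add: v_def R_def norm_divide divide_right_mono)
      show "\<not> (v n (a + of_real s * y) = 0 \<or> v n (a + of_real s * y) = 1)" if "y \<in> cball 0 1" for y
        using omit[OF s[OF that], of n] \<open>b \<noteq> c\<close> by (simp add: v_def)
      show "norm ((x - a) / of_real s) \<le> t / s"
        using that by (simp add: dist_norm norm_divide norm_minus_commute divide_right_mono)
    qed (use that in auto)
    then show ?thesis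
      using that by simp
  qed
  obtain g k where g: "g holomorphic_on ball a r" "strict_mono k"
    "\<And>x. x \<in> ball a r \<Longrightarrow> (\<lambda>n. u (k n) x) \<longlonglongrightarrow> g x"
  proof (rule Montel[of "ball a r" "range u" u])
    fix K :: "complex set" assume K: "compact K" "K \<subseteq> ball a r"
    have "\<exists>t>0. t < r \<and> K \<subseteq> cball a t"
    proof -
      have "r > 0" using z by (metis ball_eq_empty empty_iff not_le)
      \<comment> \<open>Adding \<open>a\<close> makes the set nonempty, so the distance from
        \<open>a\<close> attains a maximum on it; the radius is then taken halfway between this
        maximum and r.\<close>
      have cK: "compact (insert a K)" "insert a K \<noteq> {}" "insert a K \<subseteq> ball a r"
        using K \<open>r > 0\<close> by auto
      have "continuous_on (insert a K) (dist a)"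
        by (intro continuous_intros)
      then obtain y where y: "y \<in> insert a K" "\<And>x. x \<in> insert a K \<Longrightarrow> dist a x \<le> dist a y"
        using continuous_attains_sup[OF cK(1,2)] by blast
      have "dist a y < r" "0 \<le> dist a y"
        using y(1) cK(3) by auto
      then have "0 < (dist a y + r) / 2" "(dist a y + r) / 2 < r"
        using \<open>r > 0\<close> by (simp_all add: add_nonneg_pos)
      moreover have "K \<subseteq> cball a ((dist a y + r) / 2)"
        using y(2) \<open>dist a y < r\<close> by fastforce
      ultimately show ?thesis by blast
    qed
    then obtain t where t: "0 < t" "t < r" "K \<subseteq> cball a t" by blast
    define s where "s = (t + r) / 2"
    have s: "t < s" "s < r" using t by (auto simp: s_def)
    define C where "C = exp (pi * exp (pi * (2 + 2 * R + 12 * (t / s) / (1 - t / s))))"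
    have "cmod (u n x) \<le> C * cmod (c - b) + cmod b" if "x \<in> K" for n x
    proof -
      have "u n x = v n x * (c - b) + b"
        using \<open>b \<noteq> c\<close> by (simp add: v_def)
      then have "cmod (u n x) \<le> cmod (v n x) * cmod (c - b) + cmod b"
        by (metis norm_mult norm_triangle_ineq)
      moreover have "cmod (v n x) \<le> C"
        unfolding C_def using that t s by (intro bound) auto
      ultimately show ?thesis
        by (smt (verit) mult_right_mono norm_ge_zero)
    qed
    then show "\<exists>B. \<forall>h\<in>range u. \<forall>z\<in>K. cmod (h z) \<le> B"
      by blast
  qed (use hol in auto)
  have "r > 0" using z by (metis ball_eq_empty empty_iff not_le)
  have "g z = L"
  proof (rule analytic_continuation_open[of "B \<inter> ball a r" "ball a r" g "\<lambda>_. L"])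
    show "B \<inter> ball a r \<noteq> {}" using B \<open>r > 0\<close> by auto
    show "g x = L" if "x \<in> B \<inter> ball a r" for x
    proof (rule LIMSEQ_unique)
      show "(\<lambda>n. u (k n) x) \<longlonglongrightarrow> g x" using g(3) that by auto
      show "(\<lambda>n. u (k n) x) \<longlonglongrightarrow> L"
        using LIMSEQ_subseq_LIMSEQ[OF lim g(2)] that by (auto simp: o_def)
    qed
  qed (use B g(1) z in auto)
  then show ?thesis
    using that[OF g(2)] g(3)[OF z] by simp
qed

section \<open>The wandering domain inside the basin\<close>

lemma filterlim_add_of_nat_mult_at_infinity:
  fixes x :: "nat \<Rightarrow> complex"
  assumes "x \<longlonglongrightarrow> c" "T \<noteq> 0"
  shows "filterlim (\<lambda>n. x n + of_nat n * T) at_infinity sequentially"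
proof (rule tendsto_add_filterlim_at_infinity[OF assms(1)])
  have "filterlim (\<lambda>n. T * of_nat n) at_infinity sequentially"
    by (rule tendsto_mult_filterlim_at_infinity[OF tendsto_const assms(2) tendsto_of_nat])
  then show "filterlim (\<lambda>n. of_nat n * T) at_infinity sequentially"
    by (simp add: mult.commute)
qed

text \<open>The translates \<open>\<zeta> + m T\<close> of a point of period at most two of \<open>f\<close> do not escape under
  \<open>f\<close>, while points of the basin do. Near a point of the Fatou set of \<open>f\<close> in the closure of the
  basin, all limit functions are thus the constant \<^term>\<open>Infinity\<close>, and the iterates of
  \<open>z + p z\<close> omit all \<open>\<zeta> + m T\<close>; the theorems of Schottky and Montel then apply.\<close>

lemma fatou_set_Int_closure_basin:
  fixes T z\<^sub>0 :: complex and p :: "complex \<Rightarrow> complex"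
  defines "q \<equiv> \<lambda>z. z + p z" and "f \<equiv> \<lambda>z. z + T + p z"
  assumes T: "T \<noteq> 0" and hol: "p holomorphic_on UNIV" and per: "\<And>z. p (z + T) = p z"
    and att: "attracting_fixed_point q z\<^sub>0"
  shows "fatou_set sphere_normal f \<inter> closure (basin q z\<^sub>0) \<subseteq> basin q z\<^sub>0"
proof
  fix z assume z: "z \<in> fatou_set sphere_normal f \<inter> closure (basin q z\<^sub>0)"
  have holq: "q holomorphic_on UNIV" and holf: "f holomorphic_on UNIV"
    unfolding q_def f_def by (intro holomorphic_intros hol)+
  have fq: "(f ^^ n) x = (q ^^ n) x + of_nat n * T" for n x
    unfolding f_def q_def by (rule funpow_translate[of p T, OF per])
  have f_shift: "f (x + of_nat m * T) = f x + of_nat m * T" for x m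
    using periodic_of_nat[of p T, OF per] by (simp add: f_def)
  obtain \<zeta> where \<zeta>: "f (f \<zeta>) = \<zeta>"
  proof (rule entire_comp_self_has_fixpoint[OF holf])
    show "\<nexists>c. f = (\<lambda>z. z + c)"
    proof
      assume "\<exists>c. f = (\<lambda>z. z + c)"
      \<comment> \<open>A translation f would make q a translation too, with derivative 1 at
        \<open>z\<^sub>0\<close>, contradicting that \<open>z\<^sub>0\<close> is attracting.\<close>
      then obtain c where c: "f = (\<lambda>z. z + c)" by blast
      have "q z = z + (c - T)" for z
        using fun_cong[OF c, of z] by (simp add: f_def q_def algebra_simps)
      then have "q = (\<lambda>z. z + (c - T))" by blast
      moreover have "((\<lambda>z. z + (c - T)) has_field_derivative 1) (at z\<^sub>0)"
        by (auto intro!: derivative_eq_intros)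
      ultimately have "deriv q z\<^sub>0 = 1"
        by (simp add: DERIV_imp_deriv)
      then show False using att by (simp add: attracting_fixed_point_def)
    qed
  qed
  obtain V where V: "open V" "z \<in> V" "sphere_normal V (range (\<lambda>n. f ^^ n))"
    using z by (auto simp: fatou_set_def)
  obtain e where e: "e > 0" "ball z e \<subseteq> V"
    using V openE by blast
  have opB: "open (basin q z\<^sub>0)"
    by (rule open_basin[OF holq att])
  \<comment> \<open>With this choice the ball of radius e / 2 about a contains z and lies in the
    ball of radius e about z.\<close>
  obtain a where a: "a \<in> basin q z\<^sub>0" "dist a z < e / 2"
    using z e(1) closure_approachable[of z "basin q z\<^sub>0"] by (meson IntD2 half_gt_zero)
  have omit: "(f ^^ N) v \<noteq> \<zeta> + of_nat m * T" if v: "v \<in> ball z e" for N m v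
  proof
    assume eq: "(f ^^ N) v = \<zeta> + of_nat m * T"
    \<comment> \<open>f commutes with translation by T, so f o f fixes \<zeta> + m T and the orbit
      of v is back there at every second step after time N.\<close>
    have per2: "(f ^^ (2 * j + N)) v = \<zeta> + of_nat m * T" for j
      by (induction j) (simp_all add: eq f_shift \<zeta>)
    define \<phi> where "\<phi> j = Finite \<circ> (f ^^ (2 * j + N))" for j
    have "range \<phi> \<subseteq> (\<lambda>u. Finite \<circ> u) ` range (\<lambda>n. f ^^ n)"
      by (auto simp: \<phi>_def)
    then obtain r l where rl: "strict_mono r" "holomorphic_into sphere_atlas l V"
      "converges_on_compacts V (\<phi> \<circ> r) l"
      using V(3) unfolding sphere_normal_def atlas_normal_def by blast
    have lim: "(\<lambda>j. Finite ((f ^^ (2 * r j + N)) x)) \<longlonglongrightarrow> l x" if "x \<in> V" for x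
      using converges_on_compacts_imp_tendsto[OF rl(3) that] by (simp add: \<phi>_def)
    have sm: "strict_mono (\<lambda>j. 2 * r j + N)"
      using rl(1) by (auto simp: strict_mono_def)
    have inf: "l x = Infinity" if x: "x \<in> basin q z\<^sub>0 \<inter> ball z e" for x
    proof (rule LIMSEQ_unique)
      show "(\<lambda>j. Finite ((f ^^ (2 * r j + N)) x)) \<longlonglongrightarrow> l x"
        using x e by (intro lim) auto
      have "filterlim (\<lambda>n. (f ^^ n) x) at_infinity sequentially"
        unfolding fq using x T by (intro filterlim_add_of_nat_mult_at_infinity) (auto simp: basin_def)
      then have "filterlim (\<lambda>j. (f ^^ (2 * r j + N)) x) at_infinity sequentially"
        by (rule filterlim_compose[OF _ filterlim_subseq[OF sm]])
      then show "(\<lambda>j. Finite ((f ^^ (2 * r j + N)) x)) \<longlonglongrightarrow> Infinity"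
        by (rule filterlim_compose[OF tendsto_Finite_Infinity])
    qed
    \<comment> \<open>The limit is \<open>Infinity\<close> on the part of the basin in the ball,
      thus on the whole ball, although the orbit of v is constant along the subsequence.\<close>
    have "l v = Infinity"
      by (rule holomorphic_into_sphere_eq_Infinity[OF rl(2), of "ball z e" "basin q z\<^sub>0 \<inter> ball z e" v])
        (use inf a e v opB in \<open>auto simp: dist_commute\<close>)
    moreover have "l v = Finite (\<zeta> + of_nat m * T)"
      using lim[of v] e v by (auto simp: per2 LIMSEQ_const_iff)
    ultimately show False by simp
  qed
  \<comment> \<open>Because f^n = q^n + n T, the values \<zeta> and \<zeta> + T of q^n correspond to
    m = n and m = n + 1 in \<open>omit\<close>.\<close>
  have omitq: "(q ^^ n) v \<noteq> \<zeta> \<and> (q ^^ n) v \<noteq> \<zeta> + T" if "v \<in> ball a (e / 2)" for n v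
  proof -
    have "dist z v \<le> dist a z + dist a v"
      by (rule dist_triangle3)
    then have "v \<in> ball z e"
      using that a by simp
    from omit[OF this, of n n] omit[OF this, of n "Suc n"] show ?thesis
      by (auto simp: fq algebra_simps)
  qed
  obtain k where k: "(\<lambda>n. (q ^^ k n) z) \<longlonglongrightarrow> z\<^sub>0"
  proof (rule holomorphic_seq_tendsto_continuation[of "\<lambda>n. q ^^ n" a "e / 2" \<zeta> "\<zeta> + T" "basin q z\<^sub>0" z\<^sub>0 z])
    show "(q ^^ n) holomorphic_on ball a (e / 2)" for n
      using holomorphic_funpow[OF holq] holomorphic_on_subset by blast
  qed (use omitq T a opB in \<open>auto simp: basin_def\<close>)
  \<comment> \<open>Convergence along the subsequence \<open>k\<close> suffices: one iterate of z
    inside this disk puts z in the basin.\<close>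
  obtain r where r: "r > 0" "basin q z\<^sub>0 = (\<Union>n. (q ^^ n) -` ball z\<^sub>0 r)"
    using basin_eq_UN_vimage[OF holq att] by blast
  have "\<forall>\<^sub>F n in sequentially. (q ^^ k n) z \<in> ball z\<^sub>0 r"
    using tendstoD[OF k r(1)] by (simp add: dist_commute)
  then show "z \<in> basin q z\<^sub>0"
    unfolding r(2) by (auto simp: eventually_sequentially)
qed

text \<open>The basin is open and, by \<open>fatou_set_Int_closure_basin\<close>, its trace on the
  component is relatively closed; as it contains \<open>z\<^sub>0\<close>, connectedness gives the
  whole component.\<close>

lemma fatou_component_subset_basin:
  fixes T z\<^sub>0 :: complex and p :: "complex \<Rightarrow> complex"
  assumes T: "T \<noteq> 0" and hol: "p holomorphic_on UNIV" and per: "\<And>z. p (z + T) = p z"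
    and att: "attracting_fixed_point (\<lambda>z. z + p z) z\<^sub>0"
  shows "fatou_component (\<lambda>z. z + T + p z) z\<^sub>0 \<subseteq> basin (\<lambda>z. z + p z) z\<^sub>0"
    (is "?U \<subseteq> ?A")
\<comment> \<open>\<open>connected_component_set\<close> is empty when its base point lies outside
  the set, so this case is split off; otherwise \<open>z\<^sub>0\<close> belongs to the
  component.\<close>
proof (cases "?U = {}")
  case False
  have "(\<lambda>z. z + p z) holomorphic_on UNIV"
    by (intro holomorphic_intros hol)
  then have "openin (top_of_set ?U) (?U \<inter> ?A)"
    using open_basin att by blast
  moreover have "?U \<inter> ?A = ?U \<inter> closure ?A"
    using fatou_set_Int_closure_basin[OF assms] connected_component_subset closure_subset
    unfolding fatou_component_def by blast
  then have "closedin (top_of_set ?U) (?U \<inter> ?A)"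
    by (metis closed_closure closedin_closed_Int)
  moreover have "connected ?U"
    by (simp add: fatou_component_def)
  moreover have "((\<lambda>z. z + p z) ^^ n) z\<^sub>0 = z\<^sub>0" for n
    using att by (induction n) (auto simp: attracting_fixed_point_def)
  then have "z\<^sub>0 \<in> ?A"
    by (simp add: basin_def)
  moreover have "z\<^sub>0 \<in> ?U"
    using False unfolding fatou_component_def connected_component_eq_empty
    by (simp add: connected_component_refl)
  ultimately show ?thesis
    unfolding connected_clopen by blast
qed simp

section \<open>Normality\<close>

lemma cholomorphic_on_subset: "u cholomorphic_on S \<Longrightarrow> S' \<subseteq> S \<Longrightarrow> u cholomorphic_on S'"
  unfolding cholomorphic_on_def by (meson has_derivative_subset subsetD)

lemma cscale_zero_right: "cscale c (0::'a::complex_space) = 0"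
  using cscale_add_right[of c 0 0] by simp

lemma cholomorphic_on_const: "(\<lambda>_. a) cholomorphic_on S"
  unfolding cholomorphic_on_def
  by (intro ballI exI[of _ "\<lambda>_. 0"]) (simp add: cscale_zero_right)

lemma cholomorphic_on_ident: "(\<lambda>x. x) cholomorphic_on S"
  unfolding cholomorphic_on_def
  by (intro ballI exI[of _ "\<lambda>x. x"]) simp

lemma cholomorphic_on_compose:
  assumes "u cholomorphic_on S" "v cholomorphic_on UNIV"
  shows "v \<circ> u cholomorphic_on S"
  unfolding cholomorphic_on_def
proof
  fix x assume "x \<in> S"
  then obtain D where D: "(u has_derivative D) (at x within S)" "\<And>c y. D (cscale c y) = cscale c (D y)"
    using assms(1) unfolding cholomorphic_on_def by blast
  obtain E where E: "(v has_derivative E) (at (u x))" "\<And>c y. E (cscale c y) = cscale c (E y)"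
    using assms(2) unfolding cholomorphic_on_def by blast
  have "(v \<circ> u has_derivative E \<circ> D) (at x within S)"
    by (rule diff_chain_within[OF D(1) has_derivative_at_withinI[OF E(1)]])
  with D(2) E(2) show "\<exists>D. (v \<circ> u has_derivative D) (at x within S) \<and>
      (\<forall>c v. D (cscale c v) = cscale c (D v))"
    by (intro exI[of _ "E \<circ> D"]) simp
qed

lemma cholomorphic_funpow:
  fixes F :: "'a::complex_space \<Rightarrow> 'a"
  assumes "F cholomorphic_on UNIV"
  shows "(F ^^ n) cholomorphic_on UNIV"
  by (induction n) (auto simp: cholomorphic_on_ident id_def intro: cholomorphic_on_compose assms simp del: o_apply)

lemma holomorphic_intoI:
  assumes "(U, c) \<in> A" "open X" "\<phi> ` X \<subseteq> U" "(c \<circ> \<phi>) cholomorphic_on X"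
  shows "holomorphic_into A \<phi> X"
  unfolding holomorphic_into_def
proof
  fix x assume "x \<in> X"
  show "\<exists>(U, c)\<in>A. \<exists>W. open W \<and> x \<in> W \<and> W \<subseteq> X \<and> \<phi> ` W \<subseteq> U \<and> (c \<circ> \<phi>) cholomorphic_on W"
    unfolding case_prod_unfold
    by (rule bexI[OF _ assms(1)], rule exI[of _ X]) (use assms \<open>x \<in> X\<close> in simp)
qed

section \<open>Normality from a constant limit\<close>

text \<open>A sequence taken from a family of iterates may repeat and reorder them; \<open>m\<close>
  stands for its sequence of indices. If every index occurs only finitely often, the indices tend to
  infinity.\<close>

lemma subseq_constant_or_escaping:
  fixes m :: "nat \<Rightarrow> nat"
  shows "(\<exists>n (r :: nat \<Rightarrow> nat). strict_mono r \<and> (\<forall>j. m (r j) = n)) \<or> filterlim m at_top sequentially"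
proof (cases "\<exists>n. infinite {j. m j = n}")
  case True
  then obtain n where "infinite {j. m j = n}" by blast
  from infinite_enumerate[OF this] show ?thesis by auto
next
  case False
  have "filterlim m at_top cofinite"
    unfolding filterlim_at_top eventually_cofinite
  proof
    fix n
    have "finite (\<Union>k\<in>{..<n}. {j. m j = k})"
      using False by blast
    then show "finite {j. \<not> n \<le> m j}"
      by (rule rev_finite_subset) auto
  qed
  then show ?thesis by (simp add: cofinite_eq_sequentially)
qed

lemma eventually_prod_principal:
  "(\<forall>\<^sub>F x in F \<times>\<^sub>F principal S. P x) \<longleftrightarrow> (\<forall>\<^sub>F n in F. \<forall>x\<in>S. P (n, x))"
proof
  assume "\<forall>\<^sub>F x in F \<times>\<^sub>F principal S. P x"
  then obtain Q R where "eventually Q F" "\<forall>x\<in>S. R x" "\<And>n x. Q n \<Longrightarrow> R x \<Longrightarrow> P (n, x)"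
    unfolding eventually_prod_filter eventually_principal by blast
  then show "\<forall>\<^sub>F n in F. \<forall>x\<in>S. P (n, x)"
    by (auto elim: eventually_mono)
next
  assume "\<forall>\<^sub>F n in F. \<forall>x\<in>S. P (n, x)"
  then show "\<forall>\<^sub>F x in F \<times>\<^sub>F principal S. P x"
    unfolding eventually_prod_filter eventually_principal
    by (intro exI[of _ "\<lambda>n. \<forall>x\<in>S. P (n, x)"] exI[of _ "\<lambda>x. x \<in> S"]) auto
qed

text \<open>The product filter lets limit theorems for arbitrary filters yield uniform convergence
  to a constant.\<close>

lemma uniform_limit_iff_filterlim_prod:
  "uniform_limit S u (\<lambda>_. L) F \<longleftrightarrow> ((\<lambda>(n, x). u n x) \<longlongrightarrow> L) (F \<times>\<^sub>F principal S)"
  unfolding uniform_limit_iff tendsto_iff eventually_prod_principal by simp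

text \<open>Along a recurring index a subsequence is constantly one \<open>u n\<close>, which is its
  own limit; along escaping indices the sequence inherits the uniform limit
  \<open>L\<close>.\<close>

lemma atlas_normal_range:
  fixes u :: "nat \<Rightarrow> 'a::complex_space \<Rightarrow> 'm::metric_space"
  assumes "\<And>n. holomorphic_into A (u n) X" "holomorphic_into A (\<lambda>_. L) X"
    and lim: "uniform_limit X u (\<lambda>_. L) sequentially"
  shows "atlas_normal A X (range u)"
  unfolding atlas_normal_def
proof (intro allI impI)
  fix \<phi> :: "nat \<Rightarrow> 'a \<Rightarrow> 'm"
  assume "range \<phi> \<subseteq> range u"
  then have "\<forall>j. \<exists>n. \<phi> j = u n" by blast
  then obtain m where m: "\<And>j. \<phi> j = u (m j)" by metis
  show "\<exists>r l. strict_mono r \<and> holomorphic_into A l X \<and> converges_on_compacts X (\<phi> \<circ> r) l"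
    using subseq_constant_or_escaping[of m]
  proof (elim disjE exE conjE)
    fix n and r :: "nat \<Rightarrow> nat"
    assume 1: "strict_mono r" "\<forall>j. m (r j) = n"
    then have "\<phi> \<circ> r = (\<lambda>_. u n)" by (simp add: m fun_eq_iff)
    then have "converges_on_compacts X (\<phi> \<circ> r) (u n)"
      by (simp add: converges_on_compacts_def uniform_limit_const)
    with 1(1) assms(1) show ?thesis by blast
  next
    assume 2: "filterlim m at_top sequentially"
    have "filterlim (\<lambda>j. u (m j)) (uniformly_on X (\<lambda>_. L)) sequentially"
      by (rule filterlim_compose[OF lim 2])
    then have "converges_on_compacts X (\<phi> \<circ> id) (\<lambda>_. L)"
      unfolding converges_on_compacts_def by (auto simp: m o_def intro: uniform_limit_on_subset)
    then show ?thesis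
      using assms(2) strict_mono_id by blast
  qed
qed

text \<open>Divergence is demanded of the whole sequence, and indices tending to infinity provide
  exactly that; a recurring index gives a constant subsequence for the other alternative.\<close>

lemma compactified_normal_range:
  fixes u :: "nat \<Rightarrow> 'a::complex_space \<Rightarrow> complex \<times> complex"
  assumes "\<And>n. u n cholomorphic_on X"
    and lim: "filterlim (\<lambda>(n, x). u n x) at_infinity (sequentially \<times>\<^sub>F principal X)"
  shows "compactified_normal X (range u)"
  unfolding compactified_normal_def
proof (intro allI impI)
  fix \<phi> :: "nat \<Rightarrow> 'a \<Rightarrow> complex \<times> complex"
  assume "range \<phi> \<subseteq> range u"
  then have "\<forall>j. \<exists>n. \<phi> j = u n" by blast
  then obtain m where m: "\<And>j. \<phi> j = u (m j)" by metis
  show "diverges_on_compacts X \<phi> \<or>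
        (\<exists>r l. strict_mono r \<and> l cholomorphic_on X \<and> converges_on_compacts X (\<phi> \<circ> r) l)"
    using subseq_constant_or_escaping[of m]
  proof (elim disjE exE conjE)
    fix n and r :: "nat \<Rightarrow> nat"
    assume 1: "strict_mono r" "\<forall>j. m (r j) = n"
    then have "\<phi> \<circ> r = (\<lambda>_. u n)" by (simp add: m fun_eq_iff)
    then have "converges_on_compacts X (\<phi> \<circ> r) (u n)"
      by (simp add: converges_on_compacts_def uniform_limit_const)
    with 1(1) assms(1) show ?thesis by blast
  next
    assume 2: "filterlim m at_top sequentially"
    have "\<forall>\<^sub>F n in sequentially. \<forall>x\<in>X. R < norm (u n x)" for R
    proof -
      have "\<forall>\<^sub>F (n, x) in sequentially \<times>\<^sub>F principal X. R < norm (u n x)"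
        using lim[THEN filterlim_at_infinity_imp_norm_at_top, THEN filterlim_at_top_dense[THEN iffD1]]
        by (simp add: case_prod_unfold)
      then show ?thesis
        unfolding eventually_prod_principal by simp
    qed
    then have "\<forall>\<^sub>F j in sequentially. \<forall>x\<in>X. R < norm (\<phi> j x)" for R
      unfolding m by (rule eventually_compose_filterlim[OF _ 2])
    then have "diverges_on_compacts X \<phi>"
      unfolding diverges_on_compacts_def
    proof (intro allI impI)
      fix K R
      assume *: "\<And>R. \<forall>\<^sub>F j in sequentially. \<forall>x\<in>X. R < norm (\<phi> j x)" and "compact K \<and> K \<subseteq> X"
      show "\<forall>\<^sub>F n in sequentially. \<forall>x\<in>K. R < norm (\<phi> n x)"
        using *[of R] by eventually_elim (use \<open>compact K \<and> K \<subseteq> X\<close> in blast)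
    qed
    then show ?thesis ..
  qed
qed

section \<open>Limits and charts in the projective plane and the product of spheres\<close>

lemma continuous_proj_point: "continuous_on (- {0}) proj_point"
  using quotient_imp_continuous_map[OF quotient_map_proj_point] by simp

lemma proj_point_cmult:
  assumes "x \<noteq> 0" "c \<noteq> 0"
  shows "proj_point (c *s x) = proj_point x"
  using assms by (auto intro!: Quotient3_rel_abs[OF Quotient3_proj_plane, symmetric] exI[of _ c])

text \<open>In homogeneous coordinates [a : b : 1] = [1 : b/a : 1/a] where a is nonzero, and the
  last two entries tend to 0.\<close>

lemma tendsto_proj_embed:
  assumes a: "filterlim a at_infinity G" and b: "(b \<longlongrightarrow> 0) G"
  shows "((\<lambda>x. proj_embed (a x, b x)) \<longlongrightarrow> proj_point (vector [1, 0, 0])) G"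
proof -
  have inv: "((\<lambda>x. inverse (a x)) \<longlongrightarrow> 0) G"
    by (rule filterlim_compose[OF tendsto_inverse_0 a])
  have nz: "vector [1, y, z] \<noteq> (0::complex^3)" for y z
    by (metis vector_3(1) zero_index zero_neq_one)
  have "((\<lambda>x. vector [1, b x * inverse (a x), inverse (a x)] :: complex^3) \<longlongrightarrow> vector [1, 0, 0]) G"
  proof (rule vec_tendstoI)
    fix i :: 3
    have "i = 1 \<or> i = 2 \<or> i = 3" using exhaust_3 by blast
    then show "((\<lambda>x. (vector [1, b x * inverse (a x), inverse (a x)] :: complex^3) $ i) \<longlongrightarrow>
        vector [1, 0, 0] $ i) G"
      using inv tendsto_mult[OF b inv] by auto
  qed
  then have "((\<lambda>x. proj_point (vector [1, b x * inverse (a x), inverse (a x)]))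
      \<longlongrightarrow> proj_point (vector [1, 0, 0])) G"
    using nz by (intro continuous_on_tendsto_compose[OF continuous_proj_point]) auto
  moreover have "\<forall>\<^sub>F x in G. proj_point (vector [1, b x * inverse (a x), inverse (a x)]) =
      proj_embed (a x, b x)"
    using filterlim_at_infinity_imp_eventually_ne[OF a, of 0]
  proof eventually_elim
    case (elim x)
    have "a x *s vector [1, b x * inverse (a x), inverse (a x)] = (vector [a x, b x, 1] :: complex^3)"
      using elim by (simp add: vec_eq_iff forall_3)
    then show ?case
      using proj_point_cmult[OF nz elim, of "b x * inverse (a x)" "inverse (a x)"]
      by (simp add: proj_embed_def)
  qed
  ultimately show ?thesis
    by (rule Lim_transform_eventually)
qed

lemma nonzero_coord_proj_point:
  "x \<noteq> 0 \<Longrightarrow> nonzero_coord i (proj_point x) \<longleftrightarrow> x $ i \<noteq> 0"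
  by (rule nonzero_coord.abs_eq) (auto intro!: exI[of _ 1])

lemma coord_ratio_proj_point:
  "x \<noteq> 0 \<Longrightarrow> coord_ratio i j (proj_point x) = x $ j / x $ i"
  by (rule coord_ratio.abs_eq) (auto intro!: exI[of _ 1])

text \<open>The chart with nonzero third coordinate inverts \<open>proj_embed\<close>, so composing
  it with the embedded map returns \<open>u\<close>.\<close>

lemma holomorphic_into_proj_embed:
  assumes "open X" "u cholomorphic_on X"
  shows "holomorphic_into proj_atlas (proj_embed \<circ> u) X"
proof (rule holomorphic_intoI[OF _ \<open>open X\<close>])
  have "{3, 1, 2} = (UNIV :: 3 set)" using exhaust_3 by blast
  then show "({P. nonzero_coord 3 P}, \<lambda>P. (coord_ratio 3 1 P, coord_ratio 3 2 P)) \<in> proj_atlas"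
    unfolding proj_atlas_def by blast
  have nz: "vector [y, z, 1] \<noteq> (0::complex^3)" for y z
    by (metis vector_3(3) zero_index zero_neq_one)
  show "(proj_embed \<circ> u) ` X \<subseteq> {P. nonzero_coord 3 P}"
    by (auto simp: proj_embed_def case_prod_unfold nonzero_coord_proj_point nz)
  have "(\<lambda>P. (coord_ratio 3 1 P, coord_ratio 3 2 P)) \<circ> (proj_embed \<circ> u) = u"
    by (auto simp: proj_embed_def case_prod_unfold coord_ratio_proj_point nz fun_eq_iff)
  then show "(\<lambda>P. (coord_ratio 3 1 P, coord_ratio 3 2 P)) \<circ> (proj_embed \<circ> u) cholomorphic_on X"
    using assms by simp
qed

lemma holomorphic_into_sphere2_Finite:
  assumes "open X" "u cholomorphic_on X"
  shows "holomorphic_into sphere2_atlas (map_prod Finite Finite \<circ> u) X"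
proof (rule holomorphic_intoI[OF _ \<open>open X\<close>])
  show "((- {Infinity}) \<times> (- {Infinity}), map_prod affine_coord affine_coord) \<in> sphere2_atlas"
    unfolding sphere2_atlas_def sphere_atlas_def by blast
  show "(map_prod Finite Finite \<circ> u) ` X \<subseteq> (- {Infinity}) \<times> (- {Infinity})"
    by (auto simp: map_prod_def case_prod_unfold)
  have "map_prod affine_coord affine_coord \<circ> (map_prod Finite Finite \<circ> u) = u"
    by (auto simp: fun_eq_iff map_prod_def case_prod_unfold)
  then show "map_prod affine_coord affine_coord \<circ> (map_prod Finite Finite \<circ> u) cholomorphic_on X"
    using assms by simp
qed

lemma holomorphic_into_const:
  assumes "(U, c) \<in> A" "L \<in> U" "open X"
  shows "holomorphic_into A (\<lambda>_. L) X"
  by (rule holomorphic_intoI[OF assms(1,3)]) (use assms(2) in \<open>auto simp: o_def cholomorphic_on_const\<close>)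

text \<open>The two limits identify the uniform limit on \<open>V\<close> in each compactification:
  the added point, [1 : 0 : 0], and \<open>(Infinity, Finite 0)\<close>.\<close>

lemma normal_if_escaping:
  fixes F :: "complex \<times> complex \<Rightarrow> complex \<times> complex"
  assumes F: "F cholomorphic_on UNIV" and V: "open V"
    and fst_lim: "filterlim (\<lambda>(n, x). fst ((F ^^ n) x)) at_infinity (sequentially \<times>\<^sub>F principal V)"
    and snd_lim: "((\<lambda>(n, x). snd ((F ^^ n) x)) \<longlongrightarrow> 0) (sequentially \<times>\<^sub>F principal V)"
  shows "compactified_normal V (range (\<lambda>n. F ^^ n))"
    and "proj_normal V (range (\<lambda>n. F ^^ n))"
    and "sphere2_normal V (range (\<lambda>n. F ^^ n))"
proof -
  have holF: "(F ^^ n) cholomorphic_on V" for n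
    using cholomorphic_funpow[OF F] cholomorphic_on_subset by blast
  show "compactified_normal V (range (\<lambda>n. F ^^ n))"
  proof (rule compactified_normal_range[OF holF])
    have "filterlim (\<lambda>(n, x). norm ((F ^^ n) x)) at_top (sequentially \<times>\<^sub>F principal V)"
      by (rule filterlim_at_top_mono[OF filterlim_at_infinity_imp_norm_at_top[OF fst_lim]])
        (intro always_eventually, simp add: case_prod_unfold norm_prod_def)
    then show "filterlim (\<lambda>(n, x). (F ^^ n) x) at_infinity (sequentially \<times>\<^sub>F principal V)"
      by (intro filterlim_norm_at_top_imp_at_infinity) (simp add: case_prod_unfold)
  qed
  show "proj_normal V (range (\<lambda>n. F ^^ n))"
    unfolding proj_normal_def image_image
  proof (rule atlas_normal_range)
    show "holomorphic_into proj_atlas (proj_embed \<circ> (F ^^ n)) V" for n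
      by (rule holomorphic_into_proj_embed[OF V holF])
    \<comment> \<open>Only charts with i = 1 contain the limit [1 : 0 : 0].\<close>
    have "{1, 2, 3} = (UNIV :: 3 set)" using exhaust_3 by blast
    then have "({P. nonzero_coord 1 P}, \<lambda>P. (coord_ratio 1 2 P, coord_ratio 1 3 P)) \<in> proj_atlas"
      unfolding proj_atlas_def by blast
    moreover have "(vector [1, 0, 0] :: complex^3) \<noteq> 0"
      by (metis vector_3(1) zero_index zero_neq_one)
    ultimately show "holomorphic_into proj_atlas (\<lambda>_. proj_point (vector [1, 0, 0])) V"
      by (intro holomorphic_into_const V) (auto simp: nonzero_coord_proj_point)
    show "uniform_limit V (\<lambda>n. proj_embed \<circ> (F ^^ n)) (\<lambda>_. proj_point (vector [1, 0, 0])) sequentially"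
      unfolding uniform_limit_iff_filterlim_prod
      using tendsto_proj_embed[OF fst_lim snd_lim] by (simp add: case_prod_unfold)
  qed
  show "sphere2_normal V (range (\<lambda>n. F ^^ n))"
    unfolding sphere2_normal_def image_image
  proof (rule atlas_normal_range)
    show "holomorphic_into sphere2_atlas (map_prod Finite Finite \<circ> (F ^^ n)) V" for n
      by (rule holomorphic_into_sphere2_Finite[OF V holF])
    have "((- {Finite 0}) \<times> (- {Infinity}), map_prod infinity_coord affine_coord) \<in> sphere2_atlas"
      unfolding sphere2_atlas_def sphere_atlas_def by blast
    then show "holomorphic_into sphere2_atlas (\<lambda>_. (Infinity, Finite 0)) V"
      by (intro holomorphic_into_const V) auto
    have "((\<lambda>(n, x). Finite (snd ((F ^^ n) x))) \<longlongrightarrow> Finite 0) (sequentially \<times>\<^sub>F principal V)"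
      using isCont_tendsto_compose[OF isCont_Finite snd_lim] by (simp add: case_prod_unfold)
    moreover have "((\<lambda>(n, x). Finite (fst ((F ^^ n) x))) \<longlongrightarrow> Infinity) (sequentially \<times>\<^sub>F principal V)"
      using filterlim_compose[OF tendsto_Finite_Infinity fst_lim] by (simp add: case_prod_unfold)
    ultimately show "uniform_limit V (\<lambda>n. map_prod Finite Finite \<circ> (F ^^ n))
        (\<lambda>_. (Infinity, Finite 0)) sequentially"
      unfolding uniform_limit_iff_filterlim_prod
      by (auto simp: case_prod_unfold map_prod_def intro: tendsto_Pair)
  qed
qed

section \<open>The skew product\<close>

lemma cholomorphic_on_UNIV_imp_continuous: "u cholomorphic_on UNIV \<Longrightarrow> continuous_on UNIV u"
  unfolding cholomorphic_on_def
  by (metis UNIV_I continuous_at_imp_continuous_on has_derivative_continuous)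

lemma cholomorphic_skew_product:
  fixes f g :: "complex \<Rightarrow> complex" and h :: "complex \<times> complex \<Rightarrow> complex"
  assumes f: "f holomorphic_on UNIV" and g: "g holomorphic_on UNIV" and h: "h cholomorphic_on UNIV"
  shows "(\<lambda>(z, w). (f z + w * h (z, w), g w)) cholomorphic_on UNIV"
  unfolding cholomorphic_on_def
proof
  fix x :: "complex \<times> complex"
  obtain D where D: "(h has_derivative D) (at x)" "\<And>c v. D (cscale c v) = cscale c (D v)"
    using h unfolding cholomorphic_on_def by blast
  have df: "(f has_derivative (*) (deriv f (fst x))) (at (fst x))"
    using f holomorphic_derivI by (auto simp: has_field_derivative_def)
  have dg: "(g has_derivative (*) (deriv g (snd x))) (at (snd x))"
    using g holomorphic_derivI by (auto simp: has_field_derivative_def)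
  have "((\<lambda>x. (f (fst x) + snd x * h x, g (snd x))) has_derivative
      (\<lambda>v. (deriv f (fst x) * fst v + (snd x * D v + snd v * h x), deriv g (snd x) * snd v))) (at x)"
    by (intro has_derivative_Pair has_derivative_add has_derivative_mult D(1)
        has_derivative_compose[OF has_derivative_fst[OF has_derivative_ident] df]
        has_derivative_compose[OF has_derivative_snd[OF has_derivative_ident] dg]
        has_derivative_snd has_derivative_ident)
  moreover have "D (c * a, c * b) = c * D (a, b)" for c a b
    using D(2)[of c "(a, b)"] by (simp add: cscale_prod_def cscale_complex_def)
  ultimately show "\<exists>D. ((\<lambda>(z, w). (f z + w * h (z, w), g w)) has_derivative D) (at x within UNIV) \<and>
      (\<forall>c v. D (cscale c v) = cscale c (D v))"
    by (intro exI conjI) (auto simp: case_prod_unfold cscale_prod_def cscale_complex_def algebra_simps)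
qed

lemma snd_funpow_skew_product:
  fixes a :: "'a \<Rightarrow> 'b \<Rightarrow> 'a" and g :: "'b \<Rightarrow> 'b"
  shows "snd (((\<lambda>(z, w). (a z w, g w)) ^^ n) x) = (g ^^ n) (snd x)"
  by (induction n) (auto simp: case_prod_unfold)

text \<open>Near the orbit of \<open>z\<^sub>0\<close> the unperturbed map does not increase the distance to it, so the
  perturbations simply add up.\<close>

lemma skew_product_orbit_bound:
  fixes T z\<^sub>0 :: complex and p g :: "complex \<Rightarrow> complex" and h :: "complex \<times> complex \<Rightarrow> complex"
  defines "F \<equiv> \<lambda>(z, w). (z + T + p z + w * h (z, w), g w)"
  assumes per: "\<And>z. p (z + T) = p z"
    and contr: "\<And>z. z \<in> cball z\<^sub>0 d \<Longrightarrow> dist (z + p z) z\<^sub>0 \<le> dist z z\<^sub>0"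
    and g: "\<And>k. g ` cball 0 (\<rho> k) \<subseteq> cball 0 (\<rho> (Suc k))"
    and h: "\<And>k z w. z \<in> cball (z\<^sub>0 + of_nat k * T) d \<Longrightarrow> w \<in> cball 0 (\<rho> k) \<Longrightarrow>
      cmod (w * h (z, w)) \<le> s k"
    and start: "dist (fst ((F ^^ N) x)) (z\<^sub>0 + of_nat N * T) \<le> e" "snd ((F ^^ N) x) \<in> cball 0 (\<rho> N)"
    and s: "\<And>n. n \<ge> N \<Longrightarrow> e + sum s {N..<n} \<le> d"
    and "n \<ge> N"
  shows "dist (fst ((F ^^ n) x)) (z\<^sub>0 + of_nat n * T) \<le> e + sum s {N..<n} \<and>
    snd ((F ^^ n) x) \<in> cball 0 (\<rho> n)"
  using \<open>n \<ge> N\<close>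
proof (induction n rule: dec_induct)
  case (step n)
  define a b where "a = fst ((F ^^ n) x)" and "b = snd ((F ^^ n) x)"
  have Fn: "(F ^^ Suc n) x = (a + T + p a + b * h (a, b), g b)"
    by (simp add: a_def b_def F_def case_prod_unfold)
  have a: "dist a (z\<^sub>0 + of_nat n * T) \<le> e + sum s {N..<n}" and b: "b \<in> cball 0 (\<rho> n)"
    using step.IH by (auto simp: a_def b_def)
  \<comment> \<open>The bound on the partial sums keeps the point in the disk where \<open>h\<close>
    and, after translation, \<open>contr\<close> apply.\<close>
  have ad: "a \<in> cball (z\<^sub>0 + of_nat n * T) d"
    using a s[OF step.hyps(1)] by (simp add: dist_commute)
  have p: "p (a - of_nat n * T) = p a"
    using periodic_of_nat[of p T "a - of_nat n * T" n, OF per] by (simp only: diff_add_cancel)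
  \<comment> \<open>Translating back to \<open>z\<^sub>0\<close> splits the new displacement into
    that of the contracted point and the perturbation.\<close>
  have "a + T + p a + b * h (a, b) - (z\<^sub>0 + of_nat (Suc n) * T) =
      (a - of_nat n * T + p (a - of_nat n * T) - z\<^sub>0) + b * h (a, b)"
    unfolding p by (simp add: algebra_simps)
  then have "dist (a + T + p a + b * h (a, b)) (z\<^sub>0 + of_nat (Suc n) * T) \<le>
      dist (a - of_nat n * T + p (a - of_nat n * T)) z\<^sub>0 + cmod (b * h (a, b))"
    unfolding dist_norm by (metis norm_triangle_ineq)
  also have "\<dots> \<le> dist (a - of_nat n * T) z\<^sub>0 + s n"
    using ad b by (intro add_mono contr h) (auto simp: dist_norm algebra_simps)
  also have "dist (a - of_nat n * T) z\<^sub>0 = dist a (z\<^sub>0 + of_nat n * T)"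
    by (simp add: dist_norm algebra_simps)
  also have "\<dots> + s n \<le> e + sum s {N..<Suc n}"
    using a step.hyps(1) by simp
  finally show ?case
    unfolding Fn fst_conv snd_conv using g[of n] b by blast
qed (use start in auto)

section \<open>Bulging of the wandering domain\<close>

theorem theorem4p1:
  fixes T z\<^sub>0 :: complex
    and p g f :: "complex \<Rightarrow> complex"
    and h :: "complex \<times> complex \<Rightarrow> complex"
    and F :: "complex \<times> complex \<Rightarrow> complex \<times> complex"
    and \<delta> :: real
    and \<rho> :: "nat \<Rightarrow> real"
  assumes "T \<noteq> 0"
    and "p holomorphic_on UNIV"
    and "\<And>z. p (z + T) = p z"
    and "attracting_fixed_point (\<lambda>z. z + p z) z\<^sub>0"
    and "g holomorphic_on UNIV"
    and "attracting_fixed_point g 0"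
    and "h cholomorphic_on UNIV"
    and "f = (\<lambda>z. z + T + p z)"
    and "F = (\<lambda>(z, w). (f z + w * h (z, w), g w))"
    and "\<delta> > 0"
    and "\<And>k. \<rho> k > 0"
    and "\<And>k. g ` cball 0 (\<rho> k) \<subseteq> cball 0 (\<rho> (Suc k))"
    and "summable (\<lambda>k. \<rho> k *
           (SUP (z, w) \<in> cball (z\<^sub>0 + of_nat k * T) \<delta> \<times> cball 0 (\<rho> k). cmod (h (z, w))))"
  shows "fatou_component f z\<^sub>0 \<times> {0} \<subseteq> fatou_set compactified_normal F \<and>
         fatou_component f z\<^sub>0 \<times> {0} \<subseteq> fatou_set proj_normal F \<and>
         fatou_component f z\<^sub>0 \<times> {0} \<subseteq> fatou_set sphere2_normal F"
proof -
  define q where "q = (\<lambda>z. z + p z)"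
  define s where "s k = \<rho> k *
    (SUP (z, w) \<in> cball (z\<^sub>0 + of_nat k * T) \<delta> \<times> cball 0 (\<rho> k). cmod (h (z, w)))" for k
  have F: "F = (\<lambda>(z, w). (z + T + p z + w * h (z, w), g w))"
    using assms(8,9) by simp
  have holF: "F cholomorphic_on UNIV"
    unfolding F using assms(2,5,7) by (intro cholomorphic_skew_product holomorphic_intros)
  have holq: "q holomorphic_on UNIV"
    unfolding q_def by (intro holomorphic_intros assms(2))
  \<comment> \<open>The supremum bounds |h| because |h| is continuous, hence bounded, on the compact
    product; \<rho> k bounds |w|.\<close>
  have h_le: "cmod (w * h (z, w)) \<le> s k"
    if "z \<in> cball (z\<^sub>0 + of_nat k * T) \<delta>" "w \<in> cball 0 (\<rho> k)" for k z w
  proof -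
    let ?K = "cball (z\<^sub>0 + of_nat k * T) \<delta> \<times> cball 0 (\<rho> k)"
    have "continuous_on ?K (\<lambda>x. cmod (h x))"
      using cholomorphic_on_UNIV_imp_continuous[OF assms(7)]
      by (intro continuous_on_norm) (auto intro: continuous_on_subset)
    then have "bdd_above ((\<lambda>x. cmod (h x)) ` ?K)"
      by (intro bounded_imp_bdd_above compact_imp_bounded compact_continuous_image compact_Times) auto
    then have "cmod (h (z, w)) \<le> (SUP x \<in> ?K. cmod (h x))"
      using that by (intro cSUP_upper) auto
    then show ?thesis
      using that assms(11)[of k] by (simp add: norm_mult s_def mult_mono)
  qed
  obtain r \<mu> where r: "0 < r" "0 \<le> \<mu>" "\<mu> < 1"
    "\<And>z. z \<in> cball z\<^sub>0 r \<Longrightarrow> dist (q z) z\<^sub>0 \<le> \<mu> * dist z z\<^sub>0"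
    using attracting_fixed_point_contraction[OF holq assms(4)[folded q_def]] by metis
  obtain \<eta> \<nu> where \<eta>: "0 < \<eta>" "0 \<le> \<nu>" "\<nu> < 1" "\<And>w. w \<in> cball 0 \<eta> \<Longrightarrow> dist (g w) 0 \<le> \<nu> * dist w 0"
    using attracting_fixed_point_contraction[OF assms(5,6)] by metis
  \<comment> \<open>Small enough for the bound on h near \<open>z\<^sub>0 + of_nat k * T\<close>
    (radius \<delta>) and for the contraction of q near \<open>z\<^sub>0\<close> (radius r).\<close>
  define d where "d = min \<delta> r"
  have d: "0 < d" "d \<le> \<delta>" "d \<le> r"
    using assms(10) r(1) by (auto simp: d_def)
  have contr: "dist (z + p z) z\<^sub>0 \<le> dist z z\<^sub>0" if "z \<in> cball z\<^sub>0 d" for z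
  proof -
    have "\<mu> * dist z z\<^sub>0 \<le> dist z z\<^sub>0"
      using r(2,3) by (simp add: mult_left_le_one_le)
    then show ?thesis
      using r(4)[of z] that d by (simp add: q_def)
  qed
  have "summable s"
    using assms(13) unfolding s_def by simp
  \<comment> \<open>Half of d is left to the perturbations after time \<open>N\<^sub>0\<close>, the
    other half to the distance at which an orbit enters.\<close>
  then obtain N\<^sub>0 where N\<^sub>0: "\<And>m n. m \<ge> N\<^sub>0 \<Longrightarrow> norm (sum s {m..<n}) < d / 2"
    unfolding summable_Cauchy using d(1) by (meson half_gt_zero)
  have main: "\<exists>V. open V \<and> x \<in> V \<and> compactified_normal V (range (\<lambda>n. F ^^ n)) \<and>
      proj_normal V (range (\<lambda>n. F ^^ n)) \<and> sphere2_normal V (range (\<lambda>n. F ^^ n))"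
    if x_in: "x \<in> fatou_component f z\<^sub>0 \<times> {0}" for x
  proof -
    obtain z where x: "x = (z, 0)" "z \<in> fatou_component f z\<^sub>0"
      using x_in by auto
    have "z \<in> basin q z\<^sub>0"
      using fatou_component_subset_basin[OF assms(1-4)] x(2) unfolding assms(8) q_def by blast
    then have "\<forall>\<^sub>F n in sequentially. dist ((q ^^ n) z) z\<^sub>0 < d / 2"
      unfolding basin_def mem_Collect_eq by (rule tendstoD) (use d(1) in simp)
    then have "\<forall>\<^sub>F n in sequentially. n \<ge> N\<^sub>0 \<and> dist ((q ^^ n) z) z\<^sub>0 < d / 2"
      using eventually_ge_at_top by (rule eventually_conj[rotated])
    then obtain N where N: "N \<ge> N\<^sub>0" "dist ((q ^^ N) z) z\<^sub>0 < d / 2"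
      unfolding eventually_sequentially by blast
    \<comment> \<open>Open conditions on a starting point: at time N it is within d / 2 of
      \<open>z\<^sub>0 + of_nat N * T\<close>, with second coordinate in the disk of radius \<rho>
      N, and its initial second coordinate lies where g contracts.\<close>
    define V where "V = (F ^^ N) -` (ball (z\<^sub>0 + of_nat N * T) (d / 2) \<times> ball 0 (\<rho> N)) \<inter>
      UNIV \<times> ball 0 \<eta>"
    have "open V"
      unfolding V_def
      by (intro open_Int open_vimage open_Times cholomorphic_on_UNIV_imp_continuous
          cholomorphic_funpow holF) auto
    have "x \<in> V"
    proof -
      have "g 0 = 0"
        using assms(6) by (simp add: attracting_fixed_point_def)
      \<comment> \<open>On the line w = 0, invariant because g fixes 0, the map F reduces to
        f.\<close>
      then have "(F ^^ n) (z, 0) = ((f ^^ n) z, 0)" for n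
        by (induction n) (simp_all add: F assms(8))
      moreover have "(f ^^ N) z = (q ^^ N) z + of_nat N * T"
        unfolding assms(8) q_def by (rule funpow_translate[of p T, OF assms(3)])
      ultimately show ?thesis
        using N(2) \<eta>(1) assms(11)[of N] by (simp add: V_def x(1) dist_norm norm_minus_commute)
    qed
    \<comment> \<open>The estimate is uniform on V: at most d / 2 at time N, plus partial sums of
      the tail below d / 2.\<close>
    have fst_bound: "dist (fst ((F ^^ n) y)) (z\<^sub>0 + of_nat n * T) \<le> d" if "y \<in> V" "n \<ge> N" for n y
    proof -
      have sum: "d / 2 + sum s {N..<n} \<le> d" for n
        using N\<^sub>0[OF N(1), of n] by simp
      have "dist (fst ((F ^^ n) y)) (z\<^sub>0 + of_nat n * T) \<le> d / 2 + sum s {N..<n}"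
        unfolding F
      proof (rule skew_product_orbit_bound[THEN conjunct1])
        show "cmod (w * h (z, w)) \<le> s k"
          if "z \<in> cball (z\<^sub>0 + of_nat k * T) d" "w \<in> cball 0 (\<rho> k)" for k z w
          using that d by (intro h_le) auto
      qed (use that assms(3,12) contr sum in \<open>auto simp: V_def F dist_commute\<close>)
      then show ?thesis
        using sum[of n] by linarith
    qed
    have "filterlim (\<lambda>(n, y). fst ((F ^^ n) y)) at_infinity (sequentially \<times>\<^sub>F principal V)"
      unfolding filterlim_at_infinity[OF order_refl] eventually_prod_principal
    proof (intro allI impI)
      fix R :: real
      \<comment> \<open>The first coordinate stays within d of these escaping points, hence the
        margin d added to R.\<close>
      have "filterlim (\<lambda>n. z\<^sub>0 + of_nat n * T) at_infinity sequentially"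
        by (rule filterlim_add_of_nat_mult_at_infinity[OF tendsto_const assms(1)])
      then have "\<forall>\<^sub>F n in sequentially. R + d \<le> cmod (z\<^sub>0 + of_nat n * T)"
        by (rule filterlim_at_infinity_imp_norm_at_top[THEN filterlim_at_top[THEN iffD1], THEN spec])
      then show "\<forall>\<^sub>F n in sequentially. \<forall>y\<in>V. R \<le> norm (case (n, y) of (n, y) \<Rightarrow> fst ((F ^^ n) y))"
        using eventually_ge_at_top[of N]
      proof eventually_elim
        case (elim n)
        show ?case
        proof
          fix y assume "y \<in> V"
          then show "R \<le> norm (case (n, y) of (n, y) \<Rightarrow> fst ((F ^^ n) y))"
            using fst_bound[of y n] elim
              norm_triangle_sub[of "z\<^sub>0 + of_nat n * T" "fst ((F ^^ n) y)"]
            by (simp add: dist_norm norm_minus_commute)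
        qed
      qed
    qed
    moreover have "((\<lambda>(n, y). snd ((F ^^ n) y)) \<longlongrightarrow> 0) (sequentially \<times>\<^sub>F principal V)"
      unfolding tendsto_iff eventually_prod_principal
    proof (intro allI impI)
      fix e :: real assume "e > 0"
      \<comment> \<open>The second coordinate is iterated by g alone, so it decays geometrically at
        a rate uniform on V.\<close>
      have "(\<lambda>n. \<nu> ^ n * \<eta>) \<longlonglongrightarrow> 0"
        using \<eta> by (intro tendsto_mult_left_zero LIMSEQ_power_zero) auto
      then have "\<forall>\<^sub>F n in sequentially. \<nu> ^ n * \<eta> < e"
        using \<open>e > 0\<close> by (rule order_tendstoD)
      then show "\<forall>\<^sub>F n in sequentially. \<forall>y\<in>V. dist (case (n, y) of (n, y) \<Rightarrow> snd ((F ^^ n) y)) 0 < e"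
      proof eventually_elim
        case (elim n)
        show ?case
        proof
          fix y assume "y \<in> V"
          then have y: "snd y \<in> cball 0 \<eta>"
            by (auto simp: V_def)
          have "dist ((g ^^ n) (snd y)) 0 \<le> \<nu> ^ n * dist (snd y) 0"
            by (rule contraction_funpow[OF \<eta>(2-4) y])
          also have "\<dots> \<le> \<nu> ^ n * \<eta>"
            using y \<eta>(2) by (intro mult_left_mono) auto
          finally show "dist (case (n, y) of (n, y) \<Rightarrow> snd ((F ^^ n) y)) 0 < e"
            using elim by (simp add: F snd_funpow_skew_product)
        qed
      qed
    qed
    ultimately show ?thesis
      using normal_if_escaping[OF holF \<open>open V\<close>] \<open>open V\<close> \<open>x \<in> V\<close> by blast
  qed
  show ?thesis
    unfolding fatou_set_def using main by blast
qed

end
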